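(* Let $k\in\mathbb{Z}^2$. The sesquilinear form $\langle a,b\rangle_k:=h_k(b^\ast\# a)$, $a,b\in\mathfrak{A}(\mathbb{R}^2)$, is a scalar product on $\mathfrak{A}(\mathbb{R}^2)$, and $T_k$ is an isometric linear isomorphism of the unitary space $(\mathfrak{A}(\mathbb{R}^2),\langle\cdot,\cdot\rangle_k)$ onto the unitary space $(\mathfrak{A}(\mathbb{R}^2),(\cdot,\cdot))$, where $(\cdot,\cdot)$ is the scalar product of $L^2(\mathbb{R}^2)$. For $a,b\in\mathfrak{A}(\mathbb{R}^2)$, $$\langle a,b\rangle_k=\iint e^{2\pi(\alpha_kx_1+\beta_kx_2)}\,a\big(x_1+\tfrac{i\beta_k}{4},x_2-\tfrac{i\alpha_k}{4}\big)\,\overline{b}\big(x_1-\tfrac{i\beta_k}{4},x_2+\tfrac{i\alpha_k}{4}\big)\,dx_1dx_2 .$$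
   Context: Parameters: $q\neq\pm1$ is a complex number of modulus one, $\gamma\in\mathbb{R}$ is fixed with $q=e^{2\pi i\gamma}$, and $\alpha,\beta\in\mathbb{R}$ satisfy $\alpha\beta=\gamma$. For $k=(k_1,k_2)\in\mathbb{Z}^2$ put $\alpha_k:=\alpha+2\beta^{-1}k_1$, $\beta_k:=\beta+2\alpha^{-1}k_2$. $\mathfrak{A}(\mathbb{R}^2)$ is the space of functions $a(x_1,x_2)$ on $\mathbb{R}^2$ that extend to entire functions on $\mathbb{C}^2$ (same symbol) with $\sup_{|y_1|<\nu_1,|y_2|<\nu_2}\iint|a(x_1+iy_1,x_2+iy_2)|^2e^{4\pi(\mu_1|x_1|+\mu_2|x_2|)}dx_1dx_2<\infty$ for all $\mu_1,\mu_2,\nu_1,\nu_2>0$. It is a $\ast$-algebra with product $$(a\# b)(x_1,x_2)=4\iiiint a(u_1,u_2)b(v_1,v_2)e^{4\pi i[(x_1-u_1)(x_2-v_2)-(x_1-v_1)(x_2-u_2)]}du_1du_2dv_1dv_2$$ and involution $a^\ast(x_1,x_2)=\overline{a(x_1,x_2)}$ for real $x_1,x_2$. Here $\overline{b}$ denotes the entire extension of the complex conjugate function, i.e. $\overline{b}(z_1,z_2)=\overline{b(\overline{z_1},\overline{z_2})}$. The functional $h_k$ is $h_k(a)=\iint e^{2\pi(\alpha_kx_1+\beta_kx_2)}a(x_1,x_2)dx_1dx_2$. With $\mathcal{Q}_j$ = multiplication by $x_j$ and $\mathcal{P}_j=\frac{1}{2\pi i}\partial/\partial x_j$, $$T_k:=e^{\pi\alpha_k\mathcal{Q}_1}e^{-\frac{\pi}{2}\beta_k\mathcal{P}_1}\otimes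 e^{\pi\beta_k\mathcal{Q}_2}e^{\frac{\pi}{2}\alpha_k\mathcal{P}_2},$$ i.e. on $\mathfrak{A}(\mathbb{R}^2)$, $(T_ka)(x_1,x_2)=e^{\pi(\alpha_kx_1+\beta_kx_2)}a(x_1+\tfrac{i\beta_k}{4},x_2-\tfrac{i\alpha_k}{4})$. Scalar products are linear in the first variable. A unitary space is a complex vector space with a scalar product (positive definite). *)

theory Defs
  imports "HOL-Complex_Analysis.Complex_Analysis" "HOL-Library.Function_Algebras"
begin

text \<open>Unitary spaces of complex-valued functions, with pointwise vector space operations.\<close>

definition fun_scale :: "complex \<Rightarrow> ('a \<Rightarrow> complex) \<Rightarrow> ('a \<Rightarrow> complex)" where
  "fun_scale c f = (\<lambda>x. c * f x)"

lemma vector_space_fun_scale: "vector_space fun_scale"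
  by unfold_locales (simp_all add: fun_scale_def fun_eq_iff algebra_simps)

definition scalar_product_on ::
  "('a \<Rightarrow> complex) set \<Rightarrow> (('a \<Rightarrow> complex) \<Rightarrow> ('a \<Rightarrow> complex) \<Rightarrow> complex) \<Rightarrow> bool" where
  "scalar_product_on V s \<longleftrightarrow>
     (\<forall>a\<in>V. \<forall>b\<in>V. \<forall>c\<in>V. s (a + b) c = s a c + s b c) \<and>
     (\<forall>z. \<forall>a\<in>V. \<forall>c\<in>V. s (fun_scale z a) c = z * s a c) \<and>
     (\<forall>a\<in>V. \<forall>b\<in>V. s b a = cnj (s a b)) \<and>
     (\<forall>a\<in>V. a \<noteq> 0 \<longrightarrow> s a a \<in> \<real> \<and> 0 < Re (s a a))"

definition unitary_space ::
  "('a \<Rightarrow> complex) set \<Rightarrow> (('a \<Rightarrow> complex) \<Rightarrow> ('a \<Rightarrow> complex) \<Rightarrow> complex) \<Rightarrow> bool" where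
  "unitary_space V s \<longleftrightarrow> module.subspace fun_scale V \<and> scalar_product_on V s"

definition isometric_linear_iso ::
  "('a \<Rightarrow> complex) set \<Rightarrow> (('a \<Rightarrow> complex) \<Rightarrow> ('a \<Rightarrow> complex) \<Rightarrow> complex) \<Rightarrow>
   ('b \<Rightarrow> complex) set \<Rightarrow> (('b \<Rightarrow> complex) \<Rightarrow> ('b \<Rightarrow> complex) \<Rightarrow> complex) \<Rightarrow>
   (('a \<Rightarrow> complex) \<Rightarrow> ('b \<Rightarrow> complex)) \<Rightarrow> bool" where
  "isometric_linear_iso V s W t T \<longleftrightarrow>
     bij_betw T V W \<and>
     (\<forall>a\<in>V. \<forall>b\<in>V. T (a + b) = T a + T b) \<and>
     (\<forall>z. \<forall>a\<in>V. T (fun_scale z a) = fun_scale z (T a)) \<and>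
     (\<forall>a\<in>V. \<forall>b\<in>V. t (T a) (T b) = s a b)"

text \<open>Entire functions of two variables: the Frechet derivative exists and is complex linear
  at every point.\<close>

definition entire2 :: "(complex \<times> complex \<Rightarrow> complex) \<Rightarrow> bool" where
  "entire2 F \<longleftrightarrow>
     (\<forall>z. \<exists>c1 c2. (F has_derivative (\<lambda>h. c1 * fst h + c2 * snd h)) (at z))"

definition entire_extends :: "(complex \<times> complex \<Rightarrow> complex) \<Rightarrow> (real \<times> real \<Rightarrow> complex) \<Rightarrow> bool" where
  "entire_extends F a \<longleftrightarrow>
     entire2 F \<and> (\<forall>x1 x2. F (complex_of_real x1, complex_of_real x2) = a (x1, x2))"

definition entire_ext :: "(real \<times> real \<Rightarrow> complex) \<Rightarrow> (complex \<times> complex \<Rightarrow> complex)" where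
  "entire_ext a = (THE F. entire_extends F a)"

lemma entire2_slices:
  assumes "entire2 F"
  shows "(\<lambda>w. F (w, z2)) holomorphic_on UNIV" "(\<lambda>w. F (z1, w)) holomorphic_on UNIV"
proof -
  have "(\<lambda>w. F (w, z2)) field_differentiable (at w)" for w
  proof -
    obtain c1 c2 where d: "(F has_derivative (\<lambda>h. c1 * fst h + c2 * snd h)) (at (w, z2))"
      using assms unfolding entire2_def by blast
    have "((\<lambda>w. (w, z2)) has_derivative (\<lambda>h. (h, 0))) (at w)"
      by (intro has_derivative_Pair has_derivative_ident has_derivative_const)
    from has_derivative_compose[OF this d]
    have "((\<lambda>w. F (w, z2)) has_derivative (\<lambda>h. c1 * h)) (at w)"
      by simp
    then show ?thesis
      unfolding field_differentiable_def has_field_derivative_def by blast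
  qed
  then show "(\<lambda>w. F (w, z2)) holomorphic_on UNIV"
    by (simp add: holomorphic_on_def)
  have "(\<lambda>w. F (z1, w)) field_differentiable (at w)" for w
  proof -
    obtain c1 c2 where d: "(F has_derivative (\<lambda>h. c1 * fst h + c2 * snd h)) (at (z1, w))"
      using assms unfolding entire2_def by blast
    have "((\<lambda>w. (z1, w)) has_derivative (\<lambda>h. (0, h))) (at w)"
      by (intro has_derivative_Pair has_derivative_ident has_derivative_const)
    from has_derivative_compose[OF this d]
    have "((\<lambda>w. F (z1, w)) has_derivative (\<lambda>h. c2 * h)) (at w)"
      by simp
    then show ?thesis
      unfolding field_differentiable_def has_field_derivative_def by blast
  qed
  then show "(\<lambda>w. F (z1, w)) holomorphic_on UNIV"
    by (simp add: holomorphic_on_def)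
qed

lemma holomorphic_eq_from_reals:
  assumes "f holomorphic_on UNIV" "g holomorphic_on UNIV"
    and "\<And>x::real. f (complex_of_real x) = g (complex_of_real x)"
  shows "f z = g z"
proof -
  have lim: "(0::complex) islimpt \<real>"
    unfolding islimpt_approachable
  proof (intro allI impI)
    fix e :: real assume "0 < e"
    then show "\<exists>x'\<in>\<real>. x' \<noteq> (0::complex) \<and> dist x' 0 < e"
      by (intro bexI[of _ "complex_of_real (e / 2)"]) (auto simp del: of_real_divide)
  qed
  have hol: "(\<lambda>z. f z - g z) holomorphic_on UNIV"
    using assms(1,2) by (rule holomorphic_on_diff)
  have zero: "f w - g w = 0" if "w \<in> \<real>" for w
    using that assms(3) by (metis Reals_cases diff_self)
  have "f z - g z = 0"
    by (rule analytic_continuation[OF hol open_UNIV connected_UNIV subset_UNIV UNIV_I lim zero UNIV_I])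
  then show ?thesis by simp
qed

lemma entire_extends_unique:
  assumes "entire_extends F a" "entire_extends G a"
  shows "F = G"
proof
  fix z :: "complex \<times> complex"
  note hF = entire2_slices[of F] and hG = entire2_slices[of G]
  have ent: "entire2 F" "entire2 G" using assms by (auto simp: entire_extends_def)
  have "F (complex_of_real x1, w) = G (complex_of_real x1, w)" for x1 w
    by (rule holomorphic_eq_from_reals[OF hF(2)[OF ent(1)] hG(2)[OF ent(2)]])
       (use assms in \<open>auto simp: entire_extends_def\<close>)
  then have "F (z1, z2) = G (z1, z2)" for z1 z2
    by (rule holomorphic_eq_from_reals[OF hF(1)[OF ent(1)] hG(1)[OF ent(2)]])
  then show "F z = G z" by (cases z) simp
qed

lemma entire_ext_eq: "entire_extends F a \<Longrightarrow> entire_ext a = F"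
  unfolding entire_ext_def by (rule the_equality) (auto dest: entire_extends_unique)

text \<open>The algebra \<open>\<AA>(\<real>\<^sup>2)\<close>. Its elements are functions on the real plane.\<close>

definition frakA :: "(real \<times> real \<Rightarrow> complex) set" where
  "frakA = {a. (\<exists>F. entire_extends F a) \<and>
     (\<forall>\<mu>1>0. \<forall>\<mu>2>0. \<forall>\<nu>1>0. \<forall>\<nu>2>0.
        (SUP (y1, y2) \<in> {(y1, y2). \<bar>y1\<bar> < \<nu>1 \<and> \<bar>y2\<bar> < \<nu>2}.
           \<integral>\<^sup>+(x1, x2). ennreal ((cmod (entire_ext a (Complex x1 y1, Complex x2 y2)))\<^sup>2 *
             exp (4 * pi * (\<mu>1 * \<bar>x1\<bar> + \<mu>2 * \<bar>x2\<bar>))) \<partial>lborel) < \<infinity>)}"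

definition twisted_prod ::
  "(real \<times> real \<Rightarrow> complex) \<Rightarrow> (real \<times> real \<Rightarrow> complex) \<Rightarrow> (real \<times> real \<Rightarrow> complex)" where
  "twisted_prod a b = (\<lambda>(x1, x2). 4 * (LINT ((u1, u2), (v1, v2))|lborel. a (u1, u2) * b (v1, v2) *
     exp (4 * complex_of_real pi * \<i> *
       complex_of_real ((x1 - u1) * (x2 - v2) - (x1 - v1) * (x2 - u2)))))"

definition star :: "(real \<times> real \<Rightarrow> complex) \<Rightarrow> (real \<times> real \<Rightarrow> complex)" where
  "star a = (\<lambda>x. cnj (a x))"

text \<open>The entire extension of the conjugate function is \<open>cnj (b (cnj z1, cnj z2))\<close>.\<close>

lemma entire_ext_star:
  assumes "entire_extends F b"
  shows "entire_ext (star b) = (\<lambda>(z1, z2). cnj (F (cnj z1, cnj z2)))"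
proof (rule entire_ext_eq)
  have "\<exists>c1 c2. ((\<lambda>z. cnj (F (cnj (fst z), cnj (snd z)))) has_derivative
          (\<lambda>h. c1 * fst h + c2 * snd h)) (at w)" for w :: "complex \<times> complex"
  proof -
    obtain c1 c2 where d: "(F has_derivative (\<lambda>h. c1 * fst h + c2 * snd h))
        (at (cnj (fst w), cnj (snd w)))"
      using assms unfolding entire_extends_def entire2_def by blast
    have "((\<lambda>z. (cnj (fst z), cnj (snd z))) has_derivative (\<lambda>h. (cnj (fst h), cnj (snd h)))) (at w)"
      by (intro has_derivative_Pair has_derivative_cnj has_derivative_fst has_derivative_snd
          has_derivative_ident)
    from has_derivative_cnj[OF has_derivative_compose[OF this d]]
    show ?thesis
      by (intro exI[of _ "cnj c1"] exI[of _ "cnj c2"]) (simp add: o_def)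
  qed
  then show "entire_extends (\<lambda>(z1, z2). cnj (F (cnj z1, cnj z2))) (star b)"
    using assms by (simp add: entire_extends_def entire2_def star_def case_prod_unfold)
qed

definition l2_inner :: "(real \<times> real \<Rightarrow> complex) \<Rightarrow> (real \<times> real \<Rightarrow> complex) \<Rightarrow> complex" where
  "l2_inner a b = (LINT x|lborel. a x * cnj (b x))"

definition alpha_k :: "real \<Rightarrow> real \<Rightarrow> int \<times> int \<Rightarrow> real" where
  "alpha_k \<alpha> \<beta> k = \<alpha> + 2 * inverse \<beta> * of_int (fst k)"

definition beta_k :: "real \<Rightarrow> real \<Rightarrow> int \<times> int \<Rightarrow> real" where
  "beta_k \<alpha> \<beta> k = \<beta> + 2 * inverse \<alpha> * of_int (snd k)"

definition h_k :: "real \<Rightarrow> real \<Rightarrow> int \<times> int \<Rightarrow> (real \<times> real \<Rightarrow> complex) \<Rightarrow> complex" where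
  "h_k \<alpha> \<beta> k a = (LINT (x1, x2)|lborel.
     complex_of_real (exp (2 * pi * (alpha_k \<alpha> \<beta> k * x1 + beta_k \<alpha> \<beta> k * x2))) * a (x1, x2))"

definition form_k ::
  "real \<Rightarrow> real \<Rightarrow> int \<times> int \<Rightarrow> (real \<times> real \<Rightarrow> complex) \<Rightarrow> (real \<times> real \<Rightarrow> complex) \<Rightarrow> complex" where
  "form_k \<alpha> \<beta> k a b = h_k \<alpha> \<beta> k (twisted_prod (star b) a)"

text \<open>The operator \<open>exp (c P)\<close> with \<open>P = (1 / (2 \<pi> \<i>)) d/dx\<close> acts on entire functions as the
  shift by \<open>c / (2 \<pi> \<i>)\<close>, which produces the complex shifts below.\<close>

definition T_k ::
  "real \<Rightarrow> real \<Rightarrow> int \<times> int \<Rightarrow> (real \<times> real \<Rightarrow> complex) \<Rightarrow> (real \<times> real \<Rightarrow> complex)" where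
  "T_k \<alpha> \<beta> k a = (\<lambda>(x1, x2).
     complex_of_real (exp (pi * (alpha_k \<alpha> \<beta> k * x1 + beta_k \<alpha> \<beta> k * x2))) *
     entire_ext a (complex_of_real x1 + \<i> * complex_of_real (beta_k \<alpha> \<beta> k) / 4,
                   complex_of_real x2 - \<i> * complex_of_real (alpha_k \<alpha> \<beta> k) / 4))"

end

theory Submission
  imports Defs "HOL-Probability.Characteristic_Functions"
begin

text \<open>Write \<open>A = (\<alpha>\<^sub>k, \<beta>\<^sub>k)\<close>, \<open>J s = (s\<^sub>2, - s\<^sub>1)\<close> (called \<open>rot\<close> below), \<open>c = b\<^sup>*\<close>, and \<open>a'\<close> for the symplectic
  Fourier transform of \<open>a\<close>. Integrating out one variable of the twisted product gives
  \<open>(c # a)(x) = 4 \<integral> c(u) exp(4\<pi>i x\<cdot>Ju) a'(x - u) du\<close>. Substituting \<open>x = u + s\<close> in the functional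
  leaves \<open>4 \<integral> exp(2\<pi> A\<cdot>s) a'(s) exp(4\<pi>i s\<cdot>Ju) ds\<close> as the inner integral. Moving the contour shows that
  \<open>exp(2\<pi> A\<cdot>s) a'(s)\<close> is the transform of \<open>a(\<cdot> + i JA/2)\<close>, so by Fourier inversion the inner integral
  is \<open>a(u + i JA/2)\<close>; a second contour shift by \<open>- i JA/4\<close> distributes the shift evenly over \<open>a\<close>
  and \<open>c\<close>. The resulting formula says precisely that \<open>T\<^sub>k\<close> is isometric; since \<open>A\<cdot>JA = 0\<close>, the
  analogous operator for \<open>- A\<close> inverts it, and positivity is pulled back from \<open>L\<^sup>2\<close>.\<close>

section \<open>Inversion of the symplectic Fourier transform\<close>

text \<open>Under the weight \<open>exp(2\<pi> A\<cdot>x)\<close> the joint integral over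
  \<open>u\<close>, \<open>v\<close> and \<open>x\<close> is in general not absolutely convergent:
  the phase is unimodular and nothing decays in \<open>x\<close>. Hence the order matters.
  Integrating out \<open>v\<close> produces \<open>a'(x - u)\<close>; since \<open>a\<close> may be
  shifted to every imaginary level, \<open>a'\<close> decays faster than every exponential, the
  weight splits between \<open>c\<close> and \<open>a'\<close>, and Fubini applies to the other two
  integrals. A second obstacle is that the space is given by square integrals over horizontal
  slices, uniform in bounded levels, and not by pointwise bounds. So contour shifts work with
  integrals over slices, and inversion is proved almost everywhere, which suffices under an
  integral. Frequency \<open>4\<pi>\<close> in two dimensions gives the inversion factor
  \<open>(4\<pi>)^2 / (2\<pi>)^2 = 4\<close>, the factor of the twisted product. A shift by
  \<open>y\<close> multiplies the transform by \<open>exp(4\<pi> y\<cdot>Js)\<close>, which forces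
  \<open>y = JA/2\<close>. Conjugation reverses imaginary shifts, so only the even distribution
  turns the two factors into \<open>T\<^sub>k a\<close> and the conjugate of
  \<open>T\<^sub>k b\<close>.\<close>

lemma
  fixes f :: "'a::euclidean_space \<Rightarrow> 'b::{banach, second_countable_topology}"
  assumes c: "c \<noteq> 0" and [measurable]: "f \<in> borel_measurable borel"
  shows lborel_integral_affine: "(LINT x|lborel. f (t + c *\<^sub>R x)) = (1 / \<bar>c\<bar> ^ DIM('a)) *\<^sub>R (LINT x|lborel. f x)"
    and lborel_integrable_affine: "integrable lborel (\<lambda>x. f (t + c *\<^sub>R x)) \<longleftrightarrow> integrable lborel f"
proof -
  have "(LINT x|lborel. f x) = \<bar>c\<bar> ^ DIM('a) *\<^sub>R (LINT x|lborel. f (t + c *\<^sub>R x))"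
    by (subst lborel_affine[OF c, of t]) (simp add: integral_density integral_distr)
  then show "(LINT x|lborel. f (t + c *\<^sub>R x)) = (1 / \<bar>c\<bar> ^ DIM('a)) *\<^sub>R (LINT x|lborel. f x)"
    using c by simp
  show "integrable lborel (\<lambda>x. f (t + c *\<^sub>R x)) \<longleftrightarrow> integrable lborel f"
  proof
    assume "integrable lborel f"
    then have "integrable lborel (\<lambda>x. \<bar>c\<bar> ^ DIM('a) *\<^sub>R f (t + c *\<^sub>R x))"
      by (subst (asm) lborel_affine[OF c, of t]) (simp add: integrable_density integrable_distr_eq)
    then have "integrable lborel (\<lambda>x. (1 / \<bar>c\<bar> ^ DIM('a)) *\<^sub>R \<bar>c\<bar> ^ DIM('a) *\<^sub>R f (t + c *\<^sub>R x))"
      by (rule integrable_scaleR_right)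
    then show "integrable lborel (\<lambda>x. f (t + c *\<^sub>R x))" using c by simp
  next
    assume "integrable lborel (\<lambda>x. f (t + c *\<^sub>R x))"
    then show "integrable lborel f"
      by (subst lborel_affine[OF c, of t]) (simp add: integrable_density integrable_distr_eq)
  qed
qed

lemma lborel_nn_integral_translate:
  fixes f :: "'a::euclidean_space \<Rightarrow> ennreal"
  assumes [measurable]: "f \<in> borel_measurable borel"
  shows "(\<integral>\<^sup>+x. f (t + x) \<partial>lborel) = (\<integral>\<^sup>+x. f x \<partial>lborel)"
  by (subst (2) lborel_distr_plus[of t, symmetric]) (simp add: nn_integral_distr)

lemma cis_measurable [measurable (raw)]:
  "f \<in> borel_measurable M \<Longrightarrow> (\<lambda>x. cis (f x)) \<in> borel_measurable M"
  by (rule measurable_compose[of f M borel])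
    (auto intro!: borel_measurable_continuous_onI continuous_intros)

section \<open>The Gaussian kernel, its Fourier transform, and continuity of translations\<close>

definition gauss :: "real \<times> real \<Rightarrow> real" where
  "gauss x = std_normal_density (fst x) * std_normal_density (snd x)"

lemma gauss_eq: "gauss x = exp (- (norm x)\<^sup>2 / 2) / (2 * pi)"
  by (cases x) (simp add: gauss_def std_normal_density_def norm_Pair add_divide_distrib mult_exp_exp
      real_sqrt_mult[symmetric] power2_eq_square[symmetric])

lemma gauss_nonneg [simp]: "0 \<le> gauss x"
  by (simp add: gauss_eq)

lemma gauss_measurable [measurable]: "gauss \<in> borel_measurable borel"
  unfolding gauss_def[abs_def] by (simp add: borel_prod[symmetric])

text \<open>The Gaussian is a product of one-dimensional normal densities, so Fubini reduces its
  transform to the characteristic function \<open>exp(- s^2 / 2)\<close> of the standard normal law.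
  The factor \<open>2\<pi>\<close> compensates the normalisation of \<open>gauss\<close> as a
  probability density.\<close>

lemma
  shows gauss_integrable [simp]: "integrable lborel gauss"
    and integral_gauss_cis: "(LINT x|lborel. complex_of_real (gauss x) * cis (x \<bullet> w)) = 2 * pi * gauss w"
proof -
  have 1: "integrable lborel (\<lambda>t. std_normal_density t)"
    by (rule integrable_normal_density) simp
  have "integrable (lborel \<Otimes>\<^sub>M lborel) gauss"
    unfolding gauss_def[abs_def] split_beta[symmetric, of "\<lambda>x y. std_normal_density x * std_normal_density y"]
    by (rule lborel_pair.Fubini_integrable) (use 1 in \<open>auto simp: abs_mult\<close>)
  then show int: "integrable lborel gauss" by (simp add: lborel_prod)
  have ft: "(LINT t|lborel. complex_of_real (std_normal_density t) * cis (t * s)) = exp (- s\<^sup>2 / 2)" for s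
    using fun_cong[OF char_std_normal_distribution, of s]
    by (simp add: char_def integral_density scaleR_conv_of_real cis_conv_exp mult.commute)
  let ?h = "\<lambda>x. complex_of_real (gauss x) * cis (x \<bullet> w)"
  have "integrable lborel ?h"
    by (rule Bochner_Integration.integrable_bound[OF int]) (auto simp: norm_mult)
  then have "(LINT x|lborel. ?h x) = (LINT x|lborel. LINT y|lborel. ?h (x, y))"
    using lborel_pair.integral_fst'[of ?h] by (simp add: lborel_prod)
  also have "\<dots> = (LINT x|lborel. LINT y|lborel. (complex_of_real (std_normal_density x) * cis (x * fst w)) *
       (complex_of_real (std_normal_density y) * cis (y * snd w)))"
    by (simp add: gauss_def inner_prod_def cis_mult[symmetric] mult_ac)
  also have "\<dots> = complex_of_real (exp (- (fst w)\<^sup>2 / 2)) * exp (- (snd w)\<^sup>2 / 2)"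
    by (simp add: ft)
  also have "\<dots> = 2 * pi * gauss w"
    by (cases w) (simp add: gauss_eq norm_Pair exp_of_real[symmetric] exp_add[symmetric] diff_divide_distrib
       add_divide_distrib of_real_mult[symmetric] mult_exp_exp del: of_real_mult)
  finally show "(LINT x|lborel. ?h x) = 2 * pi * gauss w" .
qed

text \<open>A Scheffe argument replaces the usual approximation by compactly supported functions:
  continuity gives pointwise convergence of the translates, and translation invariance keeps their
  norms equal to that of \<open>f\<close>.\<close>

lemma L1_translation_continuous:
  fixes f :: "'a::euclidean_space \<Rightarrow> complex"
  assumes f: "integrable lborel f" and cont: "continuous_on UNIV f" and d: "d \<longlonglongrightarrow> 0"
  shows "(\<lambda>n. \<integral>\<^sup>+u. norm (f (u + d n) - f u) \<partial>lborel) \<longlonglongrightarrow> 0"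
proof (rule Scheffe_lemma2)
  have [measurable]: "f \<in> borel_measurable borel"
    using cont by (rule borel_measurable_continuous_onI)
  show "(\<lambda>u. f (u + d n)) \<in> borel_measurable lborel" for n by simp
  show "AE u in lborel. (\<lambda>n. f (u + d n)) \<longlonglongrightarrow> f u"
  proof (rule AE_I2)
    fix u
    have "(\<lambda>n. u + d n) \<longlonglongrightarrow> u"
      using tendsto_add[OF tendsto_const d] by simp
    moreover have "isCont f u" using cont by (simp add: continuous_on_eq_continuous_at)
    ultimately show "(\<lambda>n. f (u + d n)) \<longlonglongrightarrow> f u"
      by (rule isCont_tendsto_compose[rotated])
  qed
  show "(\<integral>\<^sup>+u. norm (f (u + d n)) \<partial>lborel) \<le> (\<integral>\<^sup>+u. norm (f u) \<partial>lborel)" for n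
    using lborel_nn_integral_translate[of "\<lambda>u. norm (f u)" "d n"] by (simp add: add.commute)
qed (rule f)

section \<open>The symplectic form \<open>v \<bullet> rot s\<close> on the plane and its Fourier
  transform\<close>

definition rot :: "real \<times> real \<Rightarrow> real \<times> real" where
  "rot s = (snd s, - fst s)"

lemma inner_rot_rot [simp]: "rot v \<bullet> rot s = v \<bullet> s"
  by (simp add: rot_def inner_prod_def)

lemma inner_rot_self [simp]: "s \<bullet> rot s = 0"
  by (simp add: rot_def inner_prod_def)

lemma norm_rot [simp]: "norm (rot s) = norm s"
  by (simp add: norm_eq_sqrt_inner)

lemma rot_measurable [measurable]: "rot \<in> borel_measurable borel"
  by (rule borel_measurable_continuous_onI) (auto simp: rot_def[abs_def] intro!: continuous_intros)

text \<open>This is the ordinary Fourier transform at the frequency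
  \<open>4 * pi *\<^sub>R rot s\<close>. Because the symplectic form is skew, the inverse transform
  has the same kernel: twice this map is formally an involution.\<close>

definition symplectic_ft :: "(real \<times> real \<Rightarrow> complex) \<Rightarrow> real \<times> real \<Rightarrow> complex" where
  "symplectic_ft f s = (LINT v|lborel. f v * cis (4 * pi * (v \<bullet> rot s)))"

lemma symplectic_ft_measurable [measurable]:
  assumes [measurable]: "f \<in> borel_measurable borel"
  shows "symplectic_ft f \<in> borel_measurable borel"
  unfolding symplectic_ft_def[abs_def] by measurable

text \<open>The Gaussian cut-off makes the inversion integral absolutely convergent as a double
  integral in \<open>s\<close> and \<open>v\<close>. After the exchange, the
  \<open>s\<close>-integral is the transform of a Gaussian of width \<open>1 / r\<close>, hence a
  Gaussian of width \<open>r / (4 * pi)\<close> centred at \<open>u\<close>. The factor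
  \<open>2 * pi\<close> gives the cut-off the value 1 at the origin.\<close>

lemma symplectic_ft_gauss_regularised:
  assumes f: "integrable lborel f" and r: "r > 0"
  shows "4 * (LINT s|lborel. symplectic_ft f s * (2 * pi * gauss (r *\<^sub>R s)) * cis (4 * pi * (s \<bullet> rot u)))
       = (LINT t|lborel. f (u + (r / (4 * pi)) *\<^sub>R t) * gauss t)"
proof -
  have [measurable]: "f \<in> borel_measurable borel" using f by auto
  let ?g = "\<lambda>s. complex_of_real (2 * pi * gauss (r *\<^sub>R s))"
  let ?K = "\<lambda>s v. f v * (?g s * cis (4 * pi * (s \<bullet> rot (u - v))))"
  have g: "integrable lborel (\<lambda>s. gauss (r *\<^sub>R s))"
    using lborel_integrable_affine[of r gauss 0] r by simp
  have "integrable (lborel \<Otimes>\<^sub>M lborel) (\<lambda>(s, v). ?K s v)"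
  proof (rule lborel_pair.Fubini_integrable)
    show "AE s in lborel. integrable lborel (\<lambda>v. case (s, v) of (s, v) \<Rightarrow> ?K s v)"
    proof (rule AE_I2)
      fix s
      have "integrable lborel (\<lambda>v. (2 * pi * gauss (r *\<^sub>R s)) * norm (f v))" using f by simp
      then show "integrable lborel (\<lambda>v. case (s, v) of (s, v) \<Rightarrow> ?K s v)"
        by (rule Bochner_Integration.integrable_bound) (auto simp: norm_mult)
    qed
  qed (use f g in \<open>auto simp: norm_mult\<close>)
  then have swap: "(LINT s|lborel. LINT v|lborel. ?K s v) = (LINT v|lborel. LINT s|lborel. ?K s v)"
    by (rule lborel_pair.Fubini_integral[symmetric])
  have inner: "(LINT s|lborel. ?g s * cis (4 * pi * (s \<bullet> rot (u - v))))
      = 4 * pi\<^sup>2 / r\<^sup>2 * gauss ((4 * pi / r) *\<^sub>R (v - u))" for v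
  proof -
    have "(LINT s|lborel. ?g s * cis (4 * pi * (s \<bullet> rot (u - v))))
      = (LINT s|lborel. (\<lambda>t. 2 * pi * (complex_of_real (gauss t) * cis (t \<bullet> ((4 * pi / r) *\<^sub>R rot (u - v))))) (0 + r *\<^sub>R s))"
      using r by (intro Bochner_Integration.integral_cong) (simp_all add: mult.assoc)
    also have "\<dots> = (1 / r\<^sup>2) *\<^sub>R (2 * pi * (2 * pi * gauss ((4 * pi / r) *\<^sub>R rot (u - v))))"
      using r by (subst lborel_integral_affine) (simp_all add: integral_gauss_cis mult.assoc power2_eq_square scaleR_conv_of_real del: inner_scaleR_right)
    \<comment> \<open>The Gaussian depends on the norm only, so the rotation and the sign
      disappear.\<close>
    also have "gauss ((4 * pi / r) *\<^sub>R rot (u - v)) = gauss ((4 * pi / r) *\<^sub>R (v - u))"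
      by (simp add: gauss_eq norm_minus_commute)
    finally show ?thesis by (simp add: scaleR_conv_of_real power2_eq_square)
  qed
  \<comment> \<open>Skew-symmetry of the symplectic form merges the phases of the transform and of
    its inverse.\<close>
  have ph: "(v \<bullet> rot s) + (s \<bullet> rot u) = s \<bullet> rot (u - v)" for v s
    by (simp add: rot_def inner_prod_def algebra_simps)
  have "4 * (LINT s|lborel. symplectic_ft f s * ?g s * cis (4 * pi * (s \<bullet> rot u)))
      = 4 * (LINT s|lborel. LINT v|lborel. ?K s v)"
  proof -
    have "symplectic_ft f s * ?g s * cis (4 * pi * (s \<bullet> rot u)) = (LINT v|lborel. ?K s v)" for s
      unfolding symplectic_ft_def mult.assoc integral_mult_left_zero[symmetric]
      by (simp add: ph[symmetric] distrib_left cis_mult[symmetric] mult_ac)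
    then show ?thesis by simp
  qed
  also have "\<dots> = 4 * (LINT v|lborel. f v * (4 * pi\<^sup>2 / r\<^sup>2 * gauss ((4 * pi / r) *\<^sub>R (v - u))))"
    unfolding swap integral_mult_right_zero inner by simp
  also have "\<dots> = (LINT t|lborel. f (u + (r / (4 * pi)) *\<^sub>R t) * gauss t)"
  proof -
    have "(LINT t|lborel. f (u + (r / (4 * pi)) *\<^sub>R t) * gauss t)
       = (LINT t|lborel. (\<lambda>v. f v * gauss ((4 * pi / r) *\<^sub>R (v - u))) (u + (r / (4 * pi)) *\<^sub>R t))"
      using r by simp
    \<comment> \<open>The factor is the inverse Jacobian of the scaling by
      \<open>r / (4 * pi)\<close> in the plane. It equals 4 times the constant
      \<open>4 * pi\<^sup>2 / r\<^sup>2\<close> of \<open>inner\<close>, which is where the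
      prefactor 4 is used up.\<close>
    also have "\<dots> = (16 * pi\<^sup>2 / r\<^sup>2) * (LINT v|lborel. f v * gauss ((4 * pi / r) *\<^sub>R (v - u)))"
      using r by (subst lborel_integral_affine) (simp_all add: scaleR_conv_of_real power2_eq_square)
    also have "\<dots> = 4 * (LINT v|lborel. f v * (4 * pi\<^sup>2 / r\<^sup>2 * gauss ((4 * pi / r) *\<^sub>R (v - u))))"
      unfolding integral_mult_right_zero[symmetric]
      by (intro Bochner_Integration.integral_cong) simp_all
    finally show ?thesis by simp
  qed
  finally show ?thesis .
qed

text \<open>Since \<open>gauss\<close> has mass 1, the error of the average is the average of the
  differences \<open>f (u + r n *\<^sub>R t) - f u\<close>. Its norm is at most the Gaussian mean of
  the translation moduli \<open>?w (r n *\<^sub>R t)\<close>, which tend to 0 for each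
  \<open>t\<close> and are bounded by twice the norm of \<open>f\<close>.\<close>

lemma gauss_approximation_L1:
  fixes f :: "real \<times> real \<Rightarrow> complex"
  assumes f: "integrable lborel f" and cont: "continuous_on UNIV f" and r: "r \<longlonglongrightarrow> 0"
  shows "(\<lambda>n. \<integral>\<^sup>+u. norm ((LINT t|lborel. f (u + r n *\<^sub>R t) * gauss t) - f u) \<partial>lborel) \<longlonglongrightarrow> 0"
proof -
  have [measurable]: "f \<in> borel_measurable borel" using f by auto
  let ?w = "\<lambda>d. \<integral>\<^sup>+u. norm (f (u + d) - f u) \<partial>lborel"
  define M where "M = (\<integral>\<^sup>+u. norm (f u) \<partial>lborel)"
  have M: "M < \<infinity>" using f by (simp add: M_def integrable_iff_bounded)
  have g2: "(LINT x|lborel. gauss x) = 1"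
    using integral_gauss_cis[of 0] by (simp add: gauss_eq[of 0])
  then have g1: "(\<integral>\<^sup>+t. gauss t \<partial>lborel) = 1"
    by (simp add: nn_integral_eq_integral)
  have wM: "?w d \<le> 2 * M" for d
  proof -
    have "?w d \<le> (\<integral>\<^sup>+u. ennreal (norm (f (d + u))) + norm (f u) \<partial>lborel)"
    proof (rule nn_integral_mono)
      show "ennreal (norm (f (u + d) - f u)) \<le> ennreal (norm (f (d + u))) + norm (f u)" for u
        using norm_triangle_ineq4[of "f (u + d)" "f u"]
        by (simp add: add.commute[of d] flip: ennreal_plus)
    qed
    also have "\<dots> = 2 * M"
      using lborel_nn_integral_translate[of "\<lambda>u. ennreal (norm (f u))" d]
      by (simp add: nn_integral_add M_def mult_2)
    finally show ?thesis .
  qed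
  have le: "(\<integral>\<^sup>+u. norm ((LINT t|lborel. f (u + c *\<^sub>R t) * gauss t) - f u) \<partial>lborel)
      \<le> (\<integral>\<^sup>+t. gauss t * ?w (c *\<^sub>R t) \<partial>lborel)" for c
  proof -
    have "ennreal (norm ((LINT t|lborel. f (u + c *\<^sub>R t) * gauss t) - f u))
      \<le> (\<integral>\<^sup>+t. norm (f (u + c *\<^sub>R t) - f u) * gauss t \<partial>lborel)" for u
    \<comment> \<open>For a single \<open>u\<close> the average need not exist as an integral. Where
      it does not, the right-hand side is infinite and the bound is trivial, whatever default value
      the Bochner integral takes.\<close>
    proof (cases "integrable lborel (\<lambda>t. (f (u + c *\<^sub>R t) - f u) * gauss t)")
      case True
      have "integrable lborel (\<lambda>t. (f (u + c *\<^sub>R t) - f u) * gauss t + f u * gauss t)"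
        by (intro Bochner_Integration.integrable_add True integrable_mult_right) simp
      then have "integrable lborel (\<lambda>t. f (u + c *\<^sub>R t) * gauss t)"
        by (simp add: algebra_simps)
      then have "(LINT t|lborel. f (u + c *\<^sub>R t) * gauss t) - f u
          = (LINT t|lborel. (f (u + c *\<^sub>R t) - f u) * gauss t)"
        by (simp add: left_diff_distrib g2)
      moreover have "ennreal (norm (LINT t|lborel. (f (u + c *\<^sub>R t) - f u) * gauss t))
          \<le> (\<integral>\<^sup>+t. norm ((f (u + c *\<^sub>R t) - f u) * gauss t) \<partial>lborel)"
        by (rule integral_norm_bound_ennreal) (rule True)
      ultimately show ?thesis by (simp add: norm_mult)
    next
      case False
      then have "(\<integral>\<^sup>+t. norm ((f (u + c *\<^sub>R t) - f u) * gauss t) \<partial>lborel) = \<infinity>"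
        by (subst (asm) integrable_iff_bounded) (auto simp: less_top[symmetric])
      then show ?thesis by (simp add: norm_mult)
    qed
    then have "(\<integral>\<^sup>+u. norm ((LINT t|lborel. f (u + c *\<^sub>R t) * gauss t) - f u) \<partial>lborel)
       \<le> (\<integral>\<^sup>+u. \<integral>\<^sup>+t. norm (f (u + c *\<^sub>R t) - f u) * gauss t \<partial>lborel \<partial>lborel)"
      by (rule nn_integral_mono)
    also have "\<dots> = (\<integral>\<^sup>+t. \<integral>\<^sup>+u. norm (f (u + c *\<^sub>R t) - f u) * gauss t \<partial>lborel \<partial>lborel)"
      by (rule lborel_pair.Fubini') measurable
    also have "\<dots> = (\<integral>\<^sup>+t. gauss t * ?w (c *\<^sub>R t) \<partial>lborel)"
    proof (intro nn_integral_cong)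
      fix t
      have "(\<integral>\<^sup>+u. norm (f (u + c *\<^sub>R t) - f u) * gauss t \<partial>lborel)
          = (\<integral>\<^sup>+u. ennreal (gauss t) * ennreal (norm (f (u + c *\<^sub>R t) - f u)) \<partial>lborel)"
        by (simp add: ennreal_mult mult.commute)
      also have "\<dots> = gauss t * ?w (c *\<^sub>R t)"
        by (rule nn_integral_cmult) measurable
      finally show "(\<integral>\<^sup>+u. norm (f (u + c *\<^sub>R t) - f u) * gauss t \<partial>lborel) = gauss t * ?w (c *\<^sub>R t)" .
    qed
    finally show ?thesis .
  qed
  have "(\<lambda>n. \<integral>\<^sup>+t. gauss t * ?w (r n *\<^sub>R t) \<partial>lborel) \<longlonglongrightarrow> (\<integral>\<^sup>+t. 0 \<partial>(lborel :: (real \<times> real) measure))"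
  proof (rule nn_integral_dominated_convergence)
    show "AE t in lborel. gauss t * ?w (r n *\<^sub>R t) \<le> gauss t * (2 * M)" for n
      by (intro AE_I2 mult_left_mono wM) simp
    show "(\<integral>\<^sup>+t. gauss t * (2 * M) \<partial>lborel) < \<infinity>"
      using M by (simp add: nn_integral_multc g1 ennreal_mult_less_top)
    show "AE t in lborel. (\<lambda>n. gauss t * ?w (r n *\<^sub>R t)) \<longlonglongrightarrow> 0"
    proof (rule AE_I2)
      fix t
      have "(\<lambda>n. ?w (r n *\<^sub>R t)) \<longlonglongrightarrow> 0"
        using tendsto_scaleR[OF r tendsto_const, of t]
        by (intro L1_translation_continuous[OF f cont]) simp
      then show "(\<lambda>n. gauss t * ?w (r n *\<^sub>R t)) \<longlonglongrightarrow> 0"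
        using ennreal_tendsto_cmult[of "gauss t" "\<lambda>n. ?w (r n *\<^sub>R t)" 0 sequentially] by simp
    qed
  qed measurable
  then have lim: "(\<lambda>n. \<integral>\<^sup>+t. gauss t * ?w (r n *\<^sub>R t) \<partial>lborel) \<longlonglongrightarrow> 0"
    by simp
  show ?thesis
    by (rule tendsto_sandwich[OF always_eventually always_eventually tendsto_const lim])
      (use le in auto)
qed

text \<open>The Gaussian averages of \<open>f\<close> converge to \<open>f\<close> in \<open>L\<^sup>1\<close> and pointwise to the inversion integral,
  so by Fatou's lemma the two limits agree almost everywhere; no bound on \<open>f\<close> is required.\<close>

theorem symplectic_ft_inversion:
  assumes f: "integrable lborel f" and cont: "continuous_on UNIV f"
    and ft: "integrable lborel (symplectic_ft f)"
  shows "AE u in lborel. 4 * (LINT s|lborel. symplectic_ft f s * cis (4 * pi * (s \<bullet> rot u))) = f u"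
proof -
  have [measurable]: "f \<in> borel_measurable borel" using f by auto
  define r where "r n = inverse (real (Suc n))" for n
  have r: "r n > 0" for n by (simp add: r_def)
  have r0: "r \<longlonglongrightarrow> 0" unfolding r_def by (rule LIMSEQ_inverse_real_of_nat)
  define F where "F n u = (LINT t|lborel. f (u + (r n / (4 * pi)) *\<^sub>R t) * gauss t)" for n u
  define g where "g u = 4 * (LINT s|lborel. symplectic_ft f s * cis (4 * pi * (s \<bullet> rot u)))" for u
  have [measurable]: "F n \<in> borel_measurable borel" for n
    unfolding F_def[abs_def] by measurable
  have [measurable]: "g \<in> borel_measurable borel"
    unfolding g_def[abs_def] by measurable
  have lim: "(\<lambda>n. F n u) \<longlonglongrightarrow> g u" for u
    unfolding F_def symplectic_ft_gauss_regularised[OF f r, symmetric] g_def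
  \<comment> \<open>The cut-off lies between 0 and 1 and tends to 1 pointwise, so the integrable
    transform itself dominates.\<close>
  proof (intro tendsto_intros integral_dominated_convergence[where w = "\<lambda>s. norm (symplectic_ft f s)"])
    show "integrable lborel (\<lambda>s. norm (symplectic_ft f s))" using ft by simp
    show "AE s in lborel. norm (symplectic_ft f s * complex_of_real (2 * pi * gauss (r n *\<^sub>R s)) *
        cis (4 * pi * (s \<bullet> rot u))) \<le> norm (symplectic_ft f s)" for n
      by (simp add: norm_mult gauss_eq mult_left_le)
    have "(\<lambda>n. 2 * pi * gauss (r n *\<^sub>R s)) \<longlonglongrightarrow> 1" for s
    proof -
      have "(\<lambda>n. exp (- (norm (r n *\<^sub>R s))\<^sup>2 / 2)) \<longlonglongrightarrow> exp (- (norm (0 *\<^sub>R s))\<^sup>2 / 2)"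
        by (intro tendsto_intros r0) simp
      then show ?thesis by (simp add: gauss_eq)
    qed
    from tendsto_of_real[OF this]
    have "(\<lambda>n. symplectic_ft f s * complex_of_real (2 * pi * gauss (r n *\<^sub>R s)) * cis (4 * pi * (s \<bullet> rot u)))
       \<longlonglongrightarrow> symplectic_ft f s * complex_of_real 1 * cis (4 * pi * (s \<bullet> rot u))" for s
      by (intro tendsto_mult tendsto_const)
    then show "AE s in lborel. (\<lambda>n. symplectic_ft f s * complex_of_real (2 * pi * gauss (r n *\<^sub>R s)) *
        cis (4 * pi * (s \<bullet> rot u))) \<longlonglongrightarrow> symplectic_ft f s * cis (4 * pi * (s \<bullet> rot u))"
      by simp
  qed measurable
  have "(\<lambda>n. r n / (4 * pi)) \<longlonglongrightarrow> 0"
    using tendsto_divide[OF r0 tendsto_const, of "4 * pi"] by simp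
  from gauss_approximation_L1[OF f cont this]
  have L1: "(\<lambda>n. \<integral>\<^sup>+u. norm (F n u - f u) \<partial>lborel) \<longlonglongrightarrow> 0"
    by (simp add: F_def)
  have "(\<integral>\<^sup>+u. norm (g u - f u) \<partial>lborel) = (\<integral>\<^sup>+u. liminf (\<lambda>n. ennreal (norm (F n u - f u))) \<partial>lborel)"
  proof (intro nn_integral_cong)
    fix u
    have "(\<lambda>n. ennreal (norm (F n u - f u))) \<longlonglongrightarrow> ennreal (norm (g u - f u))"
      by (intro tendsto_intros tendsto_ennrealI lim)
    then show "ennreal (norm (g u - f u)) = liminf (\<lambda>n. ennreal (norm (F n u - f u)))"
      by (rule lim_imp_Liminf[OF sequentially_bot, symmetric])
  qed
  also have "\<dots> \<le> liminf (\<lambda>n. \<integral>\<^sup>+u. norm (F n u - f u) \<partial>lborel)"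
    by (rule nn_integral_liminf) measurable
  also have "\<dots> = 0" using L1 by (simp add: lim_imp_Liminf)
  finally have "(\<integral>\<^sup>+u. norm (g u - f u) \<partial>lborel) = 0" by simp
  then have "AE u in lborel. g u = f u"
    by (subst (asm) nn_integral_0_iff_AE) auto
  then show ?thesis by (simp add: g_def)
qed

section \<open>Shifting integrals into the complex domain\<close>

definition cplx2 :: "real \<times> real \<Rightarrow> real \<times> real \<Rightarrow> complex \<times> complex" where
  "cplx2 x y = (Complex (fst x) (fst y), Complex (snd x) (snd y))"

lemma cplx2_add: "cplx2 (x + x') (y + y') = cplx2 x y + cplx2 x' y'"
  by (simp add: cplx2_def complex_eq_iff prod_eq_iff)

lemma continuous_cplx2: "continuous_on UNIV (\<lambda>p. cplx2 (fst p) (snd p))"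
  unfolding cplx2_def by (intro continuous_intros)

lemma entire2_continuous: "entire2 F \<Longrightarrow> continuous_on UNIV F"
  unfolding entire2_def
  by (metis continuous_at_imp_continuous_on has_derivative_continuous)

lemma entire2_cplx2_measurable [measurable (raw)]:
  assumes "entire2 F" "f \<in> borel_measurable M" "g \<in> borel_measurable M"
  shows "(\<lambda>w. F (cplx2 (f w) (g w))) \<in> borel_measurable M"
proof -
  have "continuous_on UNIV (\<lambda>p. F (cplx2 (fst p) (snd p)))"
    by (rule continuous_on_compose2[OF entire2_continuous[OF assms(1)] continuous_cplx2]) simp
  then have "(\<lambda>p. F (cplx2 (fst p) (snd p))) \<in> borel_measurable borel"
    by (rule borel_measurable_continuous_onI)
  moreover have "(\<lambda>w. (f w, g w)) \<in> M \<rightarrow>\<^sub>M borel"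
    using assms(2,3) by (simp add: borel_prod[symmetric])
  ultimately show ?thesis
    using measurable_compose[of "\<lambda>w. (f w, g w)" M borel "\<lambda>p. F (cplx2 (fst p) (snd p))" borel] by simp
qed

section \<open>Permanence properties of entire functions of two variables\<close>

lemma entire2_const: "entire2 (\<lambda>z. c)"
  unfolding entire2_def by (intro allI exI[of _ 0]) simp

lemma entire2_add: "entire2 F \<Longrightarrow> entire2 G \<Longrightarrow> entire2 (\<lambda>z. F z + G z)"
  unfolding entire2_def
proof (intro allI)
  fix z
  assume "\<forall>z. \<exists>c1 c2. (F has_derivative (\<lambda>h. c1 * fst h + c2 * snd h)) (at z)"
    "\<forall>z. \<exists>c1 c2. (G has_derivative (\<lambda>h. c1 * fst h + c2 * snd h)) (at z)"
  then obtain c1 c2 d1 d2 where "(F has_derivative (\<lambda>h. c1 * fst h + c2 * snd h)) (at z)"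
    "(G has_derivative (\<lambda>h. d1 * fst h + d2 * snd h)) (at z)" by meson
  from has_derivative_add[OF this]
  show "\<exists>c1 c2. ((\<lambda>z. F z + G z) has_derivative (\<lambda>h. c1 * fst h + c2 * snd h)) (at z)"
    by (intro exI[of _ "c1 + d1"] exI[of _ "c2 + d2"]) (simp add: algebra_simps)
qed

lemma entire2_mult: "entire2 F \<Longrightarrow> entire2 G \<Longrightarrow> entire2 (\<lambda>z. F z * G z)"
  unfolding entire2_def
proof (intro allI)
  fix z
  assume "\<forall>z. \<exists>c1 c2. (F has_derivative (\<lambda>h. c1 * fst h + c2 * snd h)) (at z)"
    "\<forall>z. \<exists>c1 c2. (G has_derivative (\<lambda>h. c1 * fst h + c2 * snd h)) (at z)"
  then obtain c1 c2 d1 d2 where "(F has_derivative (\<lambda>h. c1 * fst h + c2 * snd h)) (at z)"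
    "(G has_derivative (\<lambda>h. d1 * fst h + d2 * snd h)) (at z)" by meson
  from has_derivative_mult[OF this]
  show "\<exists>c1 c2. ((\<lambda>z. F z * G z) has_derivative (\<lambda>h. c1 * fst h + c2 * snd h)) (at z)"
    by (intro exI[of _ "F z * d1 + c1 * G z"] exI[of _ "F z * d2 + c2 * G z"]) (simp add: algebra_simps)
qed

lemma entire2_shift: 
  assumes "entire2 F"
  shows "entire2 (\<lambda>z. F (z + p))"
  unfolding entire2_def
proof
  fix z
  obtain c1 c2 where d: "(F has_derivative (\<lambda>h. c1 * fst h + c2 * snd h)) (at (z + p))"
    using assms unfolding entire2_def by meson
  have "((\<lambda>z. z + p) has_derivative (\<lambda>h. h)) (at z)"
    by (auto intro!: derivative_eq_intros)
  from has_derivative_compose[OF this d]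
  show "\<exists>c1 c2. ((\<lambda>z. F (z + p)) has_derivative (\<lambda>h. c1 * fst h + c2 * snd h)) (at z)"
    by blast
qed

lemma entire2_exp_linear: "entire2 (\<lambda>z. exp (c * fst z + d * snd z))"
  unfolding entire2_def
proof
  fix z :: "complex \<times> complex"
  let ?e = "exp (c * fst z + d * snd z)"
  have 1: "((\<lambda>z. c * fst z + d * snd z) has_derivative (\<lambda>h. c * fst h + d * snd h)) (at z)"
    by (auto intro!: derivative_eq_intros)
  have 2: "(exp has_derivative (\<lambda>h. ?e * h)) (at (c * fst z + d * snd z))"
    using DERIV_exp[of "c * fst z + d * snd z"] by (simp add: has_field_derivative_def)
  from has_derivative_compose[OF 1 2]
  show "\<exists>c1 c2. ((\<lambda>z. exp (c * fst z + d * snd z)) has_derivative (\<lambda>h. c1 * fst h + c2 * snd h)) (at z)"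
    by (intro exI[of _ "?e * c"] exI[of _ "?e * d"]) (simp add: algebra_simps)
qed

text \<open>Restriction to a complex line reduces the shift of a two-dimensional integral to the
  one-variable Cauchy theorem.\<close>

lemma entire2_line:
  assumes "entire2 F"
  shows "(\<lambda>w. F (p + (w * q1, w * q2))) holomorphic_on UNIV"
proof -
  have "(\<lambda>w. F (p + (w * q1, w * q2))) field_differentiable (at w)" for w
  proof -
    obtain c1 c2 where d: "(F has_derivative (\<lambda>h. c1 * fst h + c2 * snd h)) (at (p + (w * q1, w * q2)))"
      using assms unfolding entire2_def by meson
    have "((\<lambda>w. p + (w * q1, w * q2)) has_derivative (\<lambda>h. (h * q1, h * q2))) (at w)"
      by (auto intro!: derivative_eq_intros)
    from has_derivative_compose[OF this d]
    have "((\<lambda>w. F (p + (w * q1, w * q2))) has_derivative (\<lambda>h. (c1 * q1 + c2 * q2) * h)) (at w)"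
      by (simp add: algebra_simps)
    then show ?thesis
      unfolding field_differentiable_def has_field_derivative_def by blast
  qed
  then show ?thesis by (simp add: holomorphic_on_def)
qed

text \<open>Both sides telescope to the same four values of a primitive of \<open>f\<close>; integrated over a
  family of translates this replaces the usual contour argument, with no decay needed at the
  vertical edges.\<close>

lemma unit_square_integrals:
  assumes "f holomorphic_on UNIV"
  shows "(LINT h:{0..1}|lborel. f (Complex h 1) - f (Complex h 0))
       = \<i> * (LINT s:{0..1}|lborel. f (Complex 1 s) - f (Complex 0 s))"
proof -
  obtain P where P: "\<And>z. (P has_field_derivative f z) (at z)"
    using holomorphic_convex_primitive'[of UNIV f] assms by auto
  have cf: "continuous_on UNIV f" using assms by (rule holomorphic_on_imp_continuous_on)
  have cont: "continuous_on A (\<lambda>h. f (g h))" if "continuous_on A g" for g and A :: "real set"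
    by (rule continuous_on_compose2[OF cf that]) simp
  have h: "(LINT h:{0..1}|lborel. f (Complex h t)) = P (Complex 1 t) - P (Complex 0 t)" for t
  proof -
    have "((\<lambda>h. P (Complex h t)) has_vector_derivative f (Complex h t)) (at h within {0..1})" for h
    proof -
      have "((\<lambda>h. Complex h t) has_vector_derivative 1) (at h within {0..1})"
        unfolding Complex_eq by (auto intro!: derivative_eq_intros)
      from field_vector_diff_chain_within[OF this has_field_derivative_at_within[OF P]]
      show ?thesis by (simp add: o_def)
    qed
    then show ?thesis
      unfolding set_lebesgue_integral_def
      by (intro integral_FTC_atLeastAtMost) (auto intro!: cont continuous_intros)
  qed
  have v: "(LINT s:{0..1}|lborel. \<i> * f (Complex t s)) = P (Complex t 1) - P (Complex t 0)" for t
  proof -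
    have "((\<lambda>s. P (Complex t s)) has_vector_derivative \<i> * f (Complex t s)) (at s within {0..1})" for s
    proof -
      have "((\<lambda>s. Complex t s) has_vector_derivative \<i>) (at s within {0..1})"
        unfolding Complex_eq by (auto intro!: derivative_eq_intros simp: has_vector_derivative_def scaleR_conv_of_real mult.commute)
      from field_vector_diff_chain_within[OF this has_field_derivative_at_within[OF P]]
      show ?thesis by (simp add: o_def)
    qed
    then show ?thesis
      unfolding set_lebesgue_integral_def
      by (intro integral_FTC_atLeastAtMost) (auto intro!: cont continuous_intros)
  qed
  have i: "set_integrable lborel {0..1::real} (\<lambda>h. f (g h))" if "continuous_on {0..1} g" for g
    by (rule borel_integrable_atLeastAtMost') (rule cont[OF that])
  have "(LINT h:{0..1}|lborel. f (Complex h 1) - f (Complex h 0)) = 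
     P (Complex 1 1) - P (Complex 0 1) - (P (Complex 1 0) - P (Complex 0 0))"
    by (subst set_integral_diff) (auto intro!: i continuous_intros simp: h)
  also have "\<dots> = (P (Complex 1 1) - P (Complex 1 0)) - (P (Complex 0 1) - P (Complex 0 0))"
    by simp
  also have "\<dots> = \<i> * (LINT s:{0..1}|lborel. f (Complex 1 s) - f (Complex 0 s))"
    using v by (subst set_integral_diff) (auto intro!: i continuous_intros simp: right_diff_distrib)
  finally show ?thesis .
qed

text \<open>The bound is uniform over bounded sets of levels \<open>y\<close>, which is what permits
  Fubini when a segment of levels is averaged.\<close>

definition strip_integrable :: "(complex \<times> complex \<Rightarrow> complex) \<Rightarrow> bool" where
  "strip_integrable G \<longleftrightarrow> entire2 G \<and>
     (\<forall>\<nu>. \<exists>M::real. \<forall>y. norm y \<le> \<nu> \<longrightarrow> (\<integral>\<^sup>+x. norm (G (cplx2 x y)) \<partial>lborel) \<le> M)"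

lemma strip_integrable_integrable:
  assumes "strip_integrable G"
  shows "integrable lborel (\<lambda>x. G (cplx2 x y))"
proof -
  have [measurable]: "entire2 G" using assms by (simp add: strip_integrable_def)
  obtain M :: real where "(\<integral>\<^sup>+x. norm (G (cplx2 x y)) \<partial>lborel) \<le> M"
    using assms unfolding strip_integrable_def by blast
  then show ?thesis
    by (intro integrableI_bounded) (auto simp: le_less_trans)
qed

text \<open>Apply the unit square identity to \<open>G\<close> on the complex line through each real
  \<open>x\<close> with direction \<open>y\<close>, and integrate over all \<open>x\<close>. The
  horizontal sides yield the difference of the integrals at levels \<open>y\<close> and
  \<open>0\<close>. At each height the two vertical sides are real translates of each other by
  \<open>y\<close>, so their integrals over \<open>x\<close> cancel.\<close>

lemma strip_integral_shift:
  assumes G: "strip_integrable G"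
  shows "(LINT x|lborel. G (cplx2 x y)) = (LINT x|lborel. G (cplx2 x 0))"
proof -
  have ent [measurable]: "entire2 G" using G by (simp add: strip_integrable_def)
  obtain M :: real where M: "\<And>y'. norm y' \<le> norm y \<Longrightarrow> (\<integral>\<^sup>+x. norm (G (cplx2 x y')) \<partial>lborel) \<le> M"
    using G unfolding strip_integrable_def by meson
  let ?I = "\<lambda>y. LINT x|lborel. G (cplx2 x y)"
  define f where "f x w = G (cplx2 x 0 + (w * of_real (fst y), w * of_real (snd y)))" for x w
  have f: "f x (Complex a b) = G (cplx2 (x + a *\<^sub>R y) (b *\<^sub>R y))" for x a b
    unfolding f_def by (rule arg_cong[of _ _ G]) (simp add: cplx2_def complex_eq_iff)
  have hol: "f x holomorphic_on UNIV" for x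
    unfolding f_def by (rule entire2_line[OF ent])
  have trans: "(LINT x|lborel. G (cplx2 (x + a) b)) = ?I b" for a b
    using lborel_integral_affine[of 1 "\<lambda>x. G (cplx2 x b)" a] by (simp add: add.commute)
  have trans': "integrable lborel (\<lambda>x. G (cplx2 (x + a) b))" for a b
    using lborel_integrable_affine[of 1 "\<lambda>x. G (cplx2 x b)" a] strip_integrable_integrable[OF G]
    by (simp add: add.commute)
  have ntrans: "(\<integral>\<^sup>+x. norm (G (cplx2 (x + a) b)) \<partial>lborel) = (\<integral>\<^sup>+x. norm (G (cplx2 x b)) \<partial>lborel)" for a b
    using lborel_nn_integral_translate[of "\<lambda>x. norm (G (cplx2 x b))" a] by (simp add: add.commute)
  \<comment> \<open>One Fubini statement serves both pairs of sides: \<open>\<phi>\<close> and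
    \<open>\<phi>'\<close> are real translations, which the outer integral does not see, while
    \<open>\<psi>\<close> and \<open>\<psi>'\<close> are heights, kept in the unit interval so that
    the uniform bound \<open>M\<close> applies.\<close>
  have int: "(LINT x|lborel. (LINT h:{0..1}|lborel. G (cplx2 (x + \<phi> h *\<^sub>R y) (\<psi> h *\<^sub>R y)) - G (cplx2 (x + \<phi>' h *\<^sub>R y) (\<psi>' h *\<^sub>R y))))
      = (LINT h:{0..1}|lborel. ?I (\<psi> h *\<^sub>R y) - ?I (\<psi>' h *\<^sub>R y))"
    if [measurable]: "\<phi> \<in> borel_measurable borel" "\<psi> \<in> borel_measurable borel" "\<phi>' \<in> borel_measurable borel" "\<psi>' \<in> borel_measurable borel"
     and \<psi>: "\<And>h. h \<in> {0..1} \<Longrightarrow> \<psi> h \<in> {0..1}" "\<And>h. h \<in> {0..1} \<Longrightarrow> \<psi>' h \<in> {0..1}"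
    for \<phi> \<psi> \<phi>' \<psi>' :: "real \<Rightarrow> real"
  proof -
    define K where "K h x = indicator {0..1} h *\<^sub>R (G (cplx2 (x + \<phi> h *\<^sub>R y) (\<psi> h *\<^sub>R y)) - G (cplx2 (x + \<phi>' h *\<^sub>R y) (\<psi>' h *\<^sub>R y)))" for h x
    have [measurable]: "case_prod K \<in> borel_measurable (lborel \<Otimes>\<^sub>M lborel)"
      unfolding K_def[abs_def] by measurable
    have bd: "(\<integral>\<^sup>+x. norm (K h x) \<partial>lborel) \<le> 2 * ennreal M * indicator {0..1} h" for h
    proof (cases "h \<in> {0..1}")
      case True
      have n: "norm (t *\<^sub>R y) \<le> norm y" if "t \<in> {0..1}" for t
        using that by (simp add: mult_left_le_one_le)
      have "(\<integral>\<^sup>+x. norm (K h x) \<partial>lborel) \<le> (\<integral>\<^sup>+x. ennreal (norm (G (cplx2 (x + \<phi> h *\<^sub>R y) (\<psi> h *\<^sub>R y)))) + norm (G (cplx2 (x + \<phi>' h *\<^sub>R y) (\<psi>' h *\<^sub>R y))) \<partial>lborel)"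
        using True norm_triangle_ineq4
        by (intro nn_integral_mono) (simp add: K_def flip: ennreal_plus)
      also have "\<dots> \<le> ennreal M + ennreal M"
        by (subst nn_integral_add) (measurable, unfold ntrans, intro add_mono M n \<psi> True)
      finally show ?thesis using True by (simp add: mult_2)
    qed (simp add: K_def)
    have "(\<integral>\<^sup>+h. \<integral>\<^sup>+x. norm (K h x) \<partial>lborel \<partial>lborel) \<le> (\<integral>\<^sup>+h. 2 * ennreal M * indicator {0..1} (h::real) \<partial>lborel)"
      by (intro nn_integral_mono bd)
    also have "\<dots> < \<infinity>"
      by (simp add: nn_integral_cmult ennreal_mult_less_top)
    finally have fin: "(\<integral>\<^sup>+p. norm (case_prod K p) \<partial>(lborel \<Otimes>\<^sub>M lborel)) < \<infinity>"
      by (simp add: lborel.nn_integral_fst[symmetric])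
    have "integrable (lborel \<Otimes>\<^sub>M lborel) (case_prod K)"
      using fin by (intro integrableI_bounded) simp_all
    from lborel_pair.Fubini_integral[OF this]
    have "(LINT x|lborel. LINT h|lborel. K h x) = (LINT h|lborel. LINT x|lborel. K h x)" .
    then show ?thesis
      unfolding K_def set_lebesgue_integral_def
      by (simp add: Bochner_Integration.integral_diff trans trans')
  qed
  have sq: "(LINT h:{0..1}|lborel. G (cplx2 (x + h *\<^sub>R y) (1 *\<^sub>R y)) - G (cplx2 (x + h *\<^sub>R y) (0 *\<^sub>R y)))
      = \<i> * (LINT s:{0..1}|lborel. G (cplx2 (x + 1 *\<^sub>R y) (s *\<^sub>R y)) - G (cplx2 (x + 0 *\<^sub>R y) (s *\<^sub>R y)))" for x
    using unit_square_integrals[OF hol[of x]] unfolding f .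
  have "?I y - ?I 0 = (LINT h:{0..1::real}|lborel. ?I (1 *\<^sub>R y) - ?I (0 *\<^sub>R y))"
    by (simp add: set_integral_const)
  also have "\<dots> = (LINT x|lborel. (LINT h:{0..1}|lborel. G (cplx2 (x + h *\<^sub>R y) (1 *\<^sub>R y)) - G (cplx2 (x + h *\<^sub>R y) (0 *\<^sub>R y))))"
    by (rule int[of "\<lambda>h. h" "\<lambda>_. 1" "\<lambda>h. h" "\<lambda>_. 0", symmetric]) simp_all
  also have "\<dots> = (LINT x|lborel. \<i> * (LINT s:{0..1}|lborel. G (cplx2 (x + 1 *\<^sub>R y) (s *\<^sub>R y)) - G (cplx2 (x + 0 *\<^sub>R y) (s *\<^sub>R y))))"
    by (simp only: sq)
  also have "\<dots> = \<i> * (LINT s:{0..1}|lborel. ?I (s *\<^sub>R y) - ?I (s *\<^sub>R y))"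
    unfolding integral_mult_right_zero
    by (subst int[of "\<lambda>_. 1" "\<lambda>s. s" "\<lambda>_. 0" "\<lambda>s. s"]) (simp_all only: borel_measurable_const measurable_ident_sets)
  also have "\<dots> = 0" by simp
  finally show ?thesis by simp
qed

section \<open>Entire functions with weighted square bounds on strips\<close>

text \<open>A rotation-invariant form of the growth condition in \<open>frakA\<close>: Euclidean
  norms replace the coordinatewise weights and strips, leaving two parameters. Arbitrary real
  \<open>\<mu>\<close> and \<open>\<nu>\<close> spare sign conditions when weights are
  shifted.\<close>

definition strip_decay :: "(complex \<times> complex \<Rightarrow> complex) \<Rightarrow> bool" where
  "strip_decay F \<longleftrightarrow> entire2 F \<and>
     (\<forall>\<mu> \<nu>. \<exists>M::real. \<forall>y. norm y \<le> \<nu> \<longrightarrow>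
        (\<integral>\<^sup>+x. ennreal ((norm (F (cplx2 x y)))\<^sup>2 * exp (\<mu> * norm x)) \<partial>lborel) \<le> M)"

lemma strip_decay_entire2: "strip_decay F \<Longrightarrow> entire2 F"
  by (simp add: strip_decay_def)

lemma strip_decayE:
  assumes "strip_decay F"
  obtains M :: real where "0 \<le> M"
    "\<And>y. norm y \<le> \<nu> \<Longrightarrow> (\<integral>\<^sup>+x. ennreal ((norm (F (cplx2 x y)))\<^sup>2 * exp (\<mu> * norm x)) \<partial>lborel) \<le> M"
proof -
  obtain M :: real where "\<And>y. norm y \<le> \<nu> \<Longrightarrow> (\<integral>\<^sup>+x. ennreal ((norm (F (cplx2 x y)))\<^sup>2 * exp (\<mu> * norm x)) \<partial>lborel) \<le> M"
    using assms unfolding strip_decay_def by meson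
  then show ?thesis
    \<comment> \<open>A negative bound is truncated to 0 in \<open>ennreal\<close>, so it may be
      replaced by 0. Nonnegative bounds can later be added and multiplied.\<close>
    by (intro that[of "max 0 M"]) (auto simp: ennreal_max_0)
qed

lemma abs_fst_le_norm: "\<bar>fst x\<bar> \<le> norm (x :: real \<times> real)"
  and abs_snd_le_norm: "\<bar>snd x\<bar> \<le> norm (x :: real \<times> real)"
  using norm_fst_le[of "fst x" "snd x"] norm_snd_le[of "snd x" "fst x"] by simp_all

lemma norm_le_abs_sum: "norm (x :: real \<times> real) \<le> \<bar>fst x\<bar> + \<bar>snd x\<bar>"
  using norm_Pair_le[of "fst x" "snd x"] by simp

text \<open>All norms on the plane are equivalent and every weight and width is allowed, so each
  family of bounds controls the other.\<close>

lemma frakA_iff: "a \<in> frakA \<longleftrightarrow> (\<exists>F. entire_extends F a \<and> strip_decay F)"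
proof
  assume a: "a \<in> frakA"
  then obtain F where F: "entire_extends F a" by (auto simp: frakA_def)
  note ext = entire_ext_eq[OF F]
  have "\<exists>M::real. \<forall>y. norm y \<le> \<nu> \<longrightarrow>
        (\<integral>\<^sup>+x. ennreal ((norm (F (cplx2 x y)))\<^sup>2 * exp (\<mu> * norm x)) \<partial>lborel) \<le> M" for \<mu> \<nu>
  proof -
    \<comment> \<open>The added 1 makes \<open>m\<close> positive, as the weights of
      \<open>frakA\<close> must be, even for \<open>\<mu> = 0\<close>. In \<open>n\<close> it places
      the closed ball of radius \<open>\<nu>\<close> inside the open strip.\<close>
    define m where "m = \<bar>\<mu>\<bar> + 1"
    define n where "n = \<bar>\<nu>\<bar> + 1"
    have mn: "m > 0" "n > 0" by (auto simp: m_def n_def)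
    let ?f = "\<lambda>(y1, y2). \<integral>\<^sup>+(x1, x2). ennreal ((cmod (F (Complex x1 y1, Complex x2 y2)))\<^sup>2 *
             exp (4 * pi * (m * \<bar>x1\<bar> + m * \<bar>x2\<bar>))) \<partial>lborel"
    let ?S = "SUP y \<in> {(y1, y2). \<bar>y1\<bar> < n \<and> \<bar>y2\<bar> < n}. ?f y"
    have "?S < \<infinity>"
      using a mn unfolding frakA_def mem_Collect_eq ext by blast
    then have M: "ennreal (enn2real ?S) = ?S"
      by (intro ennreal_enn2real) (simp only: infinity_ennreal_def)
    have "(\<integral>\<^sup>+x. ennreal ((norm (F (cplx2 x y)))\<^sup>2 * exp (\<mu> * norm x)) \<partial>lborel) \<le> enn2real ?S" if y: "norm y \<le> \<nu>" for y
    proof -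
      have e: "\<mu> * norm x \<le> 4 * pi * (m * \<bar>fst x\<bar> + m * \<bar>snd x\<bar>)" for x :: "real \<times> real"
      proof -
        have "\<mu> * norm x \<le> m * norm x"
          by (rule mult_right_mono) (auto simp: m_def)
        also have "\<dots> \<le> m * (\<bar>fst x\<bar> + \<bar>snd x\<bar>)"
          using norm_le_abs_sum mn by (intro mult_left_mono) auto
        also have "\<dots> \<le> 4 * pi * (m * (\<bar>fst x\<bar> + \<bar>snd x\<bar>))"
          using mn pi_gt3 mult_right_mono[of 1 "4 * pi" "m * (\<bar>fst x\<bar> + \<bar>snd x\<bar>)"] by simp
        finally show ?thesis by (simp add: distrib_left)
      qed
      have "\<bar>fst y\<bar> < n" "\<bar>snd y\<bar> < n"
        using y abs_fst_le_norm[of y] abs_snd_le_norm[of y] by (auto simp: n_def)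
      then have "?f y \<le> ?S" by (intro SUP_upper) (auto simp: case_prod_unfold)
      moreover have "(\<integral>\<^sup>+x. ennreal ((norm (F (cplx2 x y)))\<^sup>2 * exp (\<mu> * norm x)) \<partial>lborel) \<le> ?f y"
        unfolding case_prod_unfold cplx2_def
        by (intro nn_integral_mono ennreal_leI mult_left_mono) (use e in auto)
      ultimately show ?thesis unfolding M by (rule order_trans[rotated])
    qed
    then show ?thesis by blast
  qed
  then have "strip_decay F" using F by (auto simp: strip_decay_def entire_extends_def)
  then show "\<exists>F. entire_extends F a \<and> strip_decay F" using F by blast
next
  assume "\<exists>F. entire_extends F a \<and> strip_decay F"
  then obtain F where F: "entire_extends F a" "strip_decay F" by blast
  have "(SUP (y1, y2) \<in> {(y1, y2). \<bar>y1\<bar> < \<nu>1 \<and> \<bar>y2\<bar> < \<nu>2}.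
           \<integral>\<^sup>+(x1, x2). ennreal ((cmod (F (Complex x1 y1, Complex x2 y2)))\<^sup>2 *
             exp (4 * pi * (\<mu>1 * \<bar>x1\<bar> + \<mu>2 * \<bar>x2\<bar>))) \<partial>lborel) < \<infinity>"
    if pos: "\<mu>1 > 0" "\<mu>2 > 0" for \<mu>1 \<mu>2 \<nu>1 \<nu>2
  proof -
    obtain M where M: "\<And>y. norm y \<le> \<nu>1 + \<nu>2 \<Longrightarrow>
       (\<integral>\<^sup>+x. ennreal ((norm (F (cplx2 x y)))\<^sup>2 * exp (4 * pi * (\<mu>1 + \<mu>2) * norm x)) \<partial>lborel) \<le> ennreal M"
      using strip_decayE[OF F(2)] by blast
    have e: "4 * pi * (\<mu>1 * \<bar>fst x\<bar> + \<mu>2 * \<bar>snd x\<bar>) \<le> 4 * pi * (\<mu>1 + \<mu>2) * norm x" for x :: "real \<times> real"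
    proof -
      have "\<mu>1 * \<bar>fst x\<bar> + \<mu>2 * \<bar>snd x\<bar> \<le> \<mu>1 * norm x + \<mu>2 * norm x"
        using pos abs_fst_le_norm abs_snd_le_norm by (intro add_mono mult_left_mono) auto
      then have "4 * pi * (\<mu>1 * \<bar>fst x\<bar> + \<mu>2 * \<bar>snd x\<bar>) \<le> 4 * pi * (\<mu>1 * norm x + \<mu>2 * norm x)"
        by (rule mult_left_mono) simp
      then show ?thesis by (simp add: algebra_simps)
    qed
    have "(SUP y \<in> {(y1, y2). \<bar>y1\<bar> < \<nu>1 \<and> \<bar>y2\<bar> < \<nu>2}.
           \<integral>\<^sup>+x. ennreal ((cmod (F (Complex (fst x) (fst y), Complex (snd x) (snd y))))\<^sup>2 *
             exp (4 * pi * (\<mu>1 * \<bar>fst x\<bar> + \<mu>2 * \<bar>snd x\<bar>))) \<partial>lborel) \<le> ennreal M"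
    proof (rule SUP_least)
      fix y :: "real \<times> real" assume "y \<in> {(y1, y2). \<bar>y1\<bar> < \<nu>1 \<and> \<bar>y2\<bar> < \<nu>2}"
      then have "norm y \<le> \<nu>1 + \<nu>2" using norm_le_abs_sum[of y] by auto
      from M[OF this]
      have "(\<integral>\<^sup>+x. ennreal ((norm (F (cplx2 x y)))\<^sup>2 * exp (4 * pi * (\<mu>1 + \<mu>2) * norm x)) \<partial>lborel) \<le> ennreal M" .
      moreover have "(\<integral>\<^sup>+x. ennreal ((cmod (F (Complex (fst x) (fst y), Complex (snd x) (snd y))))\<^sup>2 *
             exp (4 * pi * (\<mu>1 * \<bar>fst x\<bar> + \<mu>2 * \<bar>snd x\<bar>))) \<partial>lborel)
         \<le> (\<integral>\<^sup>+x. ennreal ((norm (F (cplx2 x y)))\<^sup>2 * exp (4 * pi * (\<mu>1 + \<mu>2) * norm x)) \<partial>lborel)"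
        unfolding cplx2_def
        by (intro nn_integral_mono ennreal_leI mult_left_mono) (use e in auto)
      ultimately show "(\<integral>\<^sup>+x. ennreal ((cmod (F (Complex (fst x) (fst y), Complex (snd x) (snd y))))\<^sup>2 *
             exp (4 * pi * (\<mu>1 * \<bar>fst x\<bar> + \<mu>2 * \<bar>snd x\<bar>))) \<partial>lborel) \<le> ennreal M"
        by (rule order_trans[rotated])
    qed
    then show ?thesis
      by (simp add: case_prod_unfold le_less_trans)
  qed
  then show "a \<in> frakA"
    using F(1) unfolding frakA_def mem_Collect_eq entire_ext_eq[OF F(1)] by blast
qed

section \<open>Operations that preserve strip decay\<close>

lemma strip_decay_shift:
  fixes F :: "complex \<times> complex \<Rightarrow> complex"
  assumes F: "strip_decay F"
  shows "strip_decay (\<lambda>z. F (z + cplx2 0 q))"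
  unfolding strip_decay_def
proof (intro conjI allI)
  show "entire2 (\<lambda>z. F (z + cplx2 0 q))"
    using F by (intro entire2_shift strip_decay_entire2)
  fix \<mu> \<nu>
  obtain M where M: "\<And>y. norm y \<le> \<nu> + norm q \<Longrightarrow>
      (\<integral>\<^sup>+x. ennreal ((norm (F (cplx2 x y)))\<^sup>2 * exp (\<mu> * norm x)) \<partial>lborel) \<le> ennreal M"
    using strip_decayE[OF F] by blast
  have "(\<integral>\<^sup>+x. ennreal ((norm (F (cplx2 x y + cplx2 0 q)))\<^sup>2 * exp (\<mu> * norm x)) \<partial>lborel) \<le> M"
    if "norm y \<le> \<nu>" for y
    using M[of "y + q"] norm_triangle_ineq[of y q] that by (simp flip: cplx2_add)
  then show "\<exists>M::real. \<forall>y. norm y \<le> \<nu> \<longrightarrow>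
      (\<integral>\<^sup>+x. ennreal ((norm (F (cplx2 x y + cplx2 0 q)))\<^sup>2 * exp (\<mu> * norm x)) \<partial>lborel) \<le> M"
    by blast
qed

text \<open>With \<open>K = norm c + norm d\<close>, the exponential is at most
  \<open>exp (K * (norm x + \<nu>))\<close> on the strip. Its square costs a constant and an
  increase of the weight from \<open>\<mu>\<close> to \<open>\<mu> + 2 * K\<close>, which is
  harmless because every weight is available.\<close>

lemma strip_decay_mult_exp:
  fixes F :: "complex \<times> complex \<Rightarrow> complex"
  assumes F: "strip_decay F"
  shows "strip_decay (\<lambda>z. F z * exp (c * fst z + d * snd z))"
  unfolding strip_decay_def
proof (intro conjI allI)
  note [measurable] = strip_decay_entire2[OF F]
  show "entire2 (\<lambda>z. F z * exp (c * fst z + d * snd z))"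
    using F by (intro entire2_mult entire2_exp_linear strip_decay_entire2)
  fix \<mu> \<nu>
  define K where "K = norm c + norm d"
  obtain M where "0 \<le> M" and M: "\<And>y. norm y \<le> \<nu> \<Longrightarrow>
      (\<integral>\<^sup>+x. ennreal ((norm (F (cplx2 x y)))\<^sup>2 * exp ((\<mu> + 2 * K) * norm x)) \<partial>lborel) \<le> ennreal M"
    using strip_decayE[OF F] by blast
  let ?E = "\<lambda>z. exp (c * fst z + d * snd z)"
  have "(\<integral>\<^sup>+x. ennreal ((norm (F (cplx2 x y) * ?E (cplx2 x y)))\<^sup>2 * exp (\<mu> * norm x)) \<partial>lborel)
     \<le> ennreal (exp (2 * K * \<nu>) * M)"
    if y: "norm y \<le> \<nu>" for y
  proof -
    have le: "(norm (F (cplx2 x y) * ?E (cplx2 x y)))\<^sup>2 * exp (\<mu> * norm x)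
       \<le> exp (2 * K * \<nu>) * ((norm (F (cplx2 x y)))\<^sup>2 * exp ((\<mu> + 2 * K) * norm x))" for x
    proof -
      have z: "norm (fst (cplx2 x y)) \<le> norm x + norm y" "norm (snd (cplx2 x y)) \<le> norm x + norm y"
        using cmod_le[of "fst (cplx2 x y)"] cmod_le[of "snd (cplx2 x y)"]
          abs_fst_le_norm[of x] abs_fst_le_norm[of y] abs_snd_le_norm[of x] abs_snd_le_norm[of y]
        by (simp_all add: cplx2_def)
      have "Re (c * fst (cplx2 x y) + d * snd (cplx2 x y)) \<le> norm (c * fst (cplx2 x y) + d * snd (cplx2 x y))"
        by (rule complex_Re_le_cmod)
      also have "\<dots> \<le> norm c * norm (fst (cplx2 x y)) + norm d * norm (snd (cplx2 x y))"
        by (rule order_trans[OF norm_triangle_ineq]) (simp add: norm_mult)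
      also have "\<dots> \<le> norm c * (norm x + norm y) + norm d * (norm x + norm y)"
        using z by (intro add_mono mult_left_mono) auto
      also have "\<dots> = K * (norm x + norm y)" by (simp add: K_def algebra_simps)
      also have "\<dots> \<le> K * (norm x + \<nu>)"
        using y by (intro mult_left_mono) (auto simp: K_def)
      finally have "norm (?E (cplx2 x y)) \<le> exp (K * (norm x + \<nu>))" by (simp add: norm_exp_eq_Re)
      then have "(norm (?E (cplx2 x y)))\<^sup>2 \<le> (exp (K * (norm x + \<nu>)))\<^sup>2"
        by (rule power_mono) simp
      also have "\<dots> = exp (2 * K * \<nu>) * exp (2 * K * norm x)"
        by (simp add: algebra_simps flip: exp_add exp_double)
      finally have "(norm (F (cplx2 x y)))\<^sup>2 * exp (\<mu> * norm x) * (norm (?E (cplx2 x y)))\<^sup>2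
          \<le> (norm (F (cplx2 x y)))\<^sup>2 * exp (\<mu> * norm x) * (exp (2 * K * \<nu>) * exp (2 * K * norm x))"
        by (rule mult_left_mono) simp
      moreover have "exp ((\<mu> + 2 * K) * norm x) = exp (\<mu> * norm x) * exp (2 * K * norm x)"
        by (simp add: distrib_right exp_add)
      ultimately show ?thesis
        by (simp only: norm_mult power_mult_distrib mult_ac)
    qed
    have "(\<integral>\<^sup>+x. ennreal ((norm (F (cplx2 x y) * ?E (cplx2 x y)))\<^sup>2 * exp (\<mu> * norm x)) \<partial>lborel)
      \<le> (\<integral>\<^sup>+x. ennreal (exp (2 * K * \<nu>)) * ennreal ((norm (F (cplx2 x y)))\<^sup>2 * exp ((\<mu> + 2 * K) * norm x)) \<partial>lborel)"
      by (intro nn_integral_mono) (use le in \<open>simp flip: ennreal_mult\<close>)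
    also have "\<dots> = ennreal (exp (2 * K * \<nu>)) * (\<integral>\<^sup>+x. ennreal ((norm (F (cplx2 x y)))\<^sup>2 * exp ((\<mu> + 2 * K) * norm x)) \<partial>lborel)"
      by (rule nn_integral_cmult) measurable
    also have "\<dots> \<le> ennreal (exp (2 * K * \<nu>)) * ennreal M"
      by (intro mult_left_mono M y) simp
    finally show ?thesis using \<open>0 \<le> M\<close> by (simp add: ennreal_mult)
  qed
  then show "\<exists>M::real. \<forall>y. norm y \<le> \<nu> \<longrightarrow>
      (\<integral>\<^sup>+x. ennreal ((norm (F (cplx2 x y) * ?E (cplx2 x y)))\<^sup>2 * exp (\<mu> * norm x)) \<partial>lborel) \<le> M"
    by blast
qed

lemma strip_decay_add:
  fixes F G :: "complex \<times> complex \<Rightarrow> complex"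
  assumes F: "strip_decay F" and G: "strip_decay G"
  shows "strip_decay (\<lambda>z. F z + G z)"
  unfolding strip_decay_def
proof (intro conjI allI)
  note [measurable] = strip_decay_entire2[OF F] strip_decay_entire2[OF G]
  show "entire2 (\<lambda>z. F z + G z)"
    using F G by (intro entire2_add strip_decay_entire2)
  fix \<mu> \<nu>
  obtain M where M: "0 \<le> M" "\<And>y. norm y \<le> \<nu> \<Longrightarrow>
      (\<integral>\<^sup>+x. ennreal ((norm (F (cplx2 x y)))\<^sup>2 * exp (\<mu> * norm x)) \<partial>lborel) \<le> ennreal M"
    using strip_decayE[OF F] by blast
  obtain N where N: "0 \<le> N" "\<And>y. norm y \<le> \<nu> \<Longrightarrow>
      (\<integral>\<^sup>+x. ennreal ((norm (G (cplx2 x y)))\<^sup>2 * exp (\<mu> * norm x)) \<partial>lborel) \<le> ennreal N"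
    using strip_decayE[OF G] by blast
  have sq: "(norm (p + q))\<^sup>2 \<le> 2 * (norm p)\<^sup>2 + 2 * (norm q)\<^sup>2" for p q :: complex
  proof -
    have "(norm (p + q))\<^sup>2 \<le> (norm p + norm q)\<^sup>2"
      by (rule power_mono[OF norm_triangle_ineq]) simp
    also have "\<dots> \<le> 2 * (norm p)\<^sup>2 + 2 * (norm q)\<^sup>2"
      using sum_squares_bound[of "norm p" "norm q"] by (simp add: power2_sum)
    finally show ?thesis .
  qed
  have "(\<integral>\<^sup>+x. ennreal ((norm (F (cplx2 x y) + G (cplx2 x y)))\<^sup>2 * exp (\<mu> * norm x)) \<partial>lborel)
      \<le> ennreal (2 * M + 2 * N)" if y: "norm y \<le> \<nu>" for y
  proof -
    let ?f = "\<lambda>F x. ennreal ((norm (F (cplx2 x y)))\<^sup>2 * exp (\<mu> * norm x))"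
    have "(\<integral>\<^sup>+x. ennreal ((norm (F (cplx2 x y) + G (cplx2 x y)))\<^sup>2 * exp (\<mu> * norm x)) \<partial>lborel)
      \<le> (\<integral>\<^sup>+x. 2 * ?f F x + 2 * ?f G x \<partial>lborel)"
    proof (rule nn_integral_mono)
      fix x
      have "ennreal ((norm (F (cplx2 x y) + G (cplx2 x y)))\<^sup>2 * exp (\<mu> * norm x))
         \<le> ennreal ((2 * (norm (F (cplx2 x y)))\<^sup>2 + 2 * (norm (G (cplx2 x y)))\<^sup>2) * exp (\<mu> * norm x))"
        by (intro ennreal_leI mult_right_mono sq) simp
      also have "\<dots> = ennreal 2 * ?f F x + ennreal 2 * ?f G x"
        by (simp add: distrib_right mult.assoc flip: ennreal_plus ennreal_mult del: ennreal_numeral)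
      finally show "ennreal ((norm (F (cplx2 x y) + G (cplx2 x y)))\<^sup>2 * exp (\<mu> * norm x)) \<le> 2 * ?f F x + 2 * ?f G x"
        by simp
    qed
    also have "\<dots> = 2 * (\<integral>\<^sup>+x. ?f F x \<partial>lborel) + 2 * (\<integral>\<^sup>+x. ?f G x \<partial>lborel)"
      by (simp add: nn_integral_add nn_integral_cmult)
    also have "\<dots> \<le> ennreal 2 * ennreal M + ennreal 2 * ennreal N"
      using M(2)[OF y] N(2)[OF y] by (intro add_mono mult_mono) simp_all
    also have "\<dots> = ennreal (2 * M + 2 * N)"
      using M N by (simp flip: ennreal_plus ennreal_mult del: ennreal_numeral)
    finally show ?thesis .
  qed
  then show "\<exists>M::real. \<forall>y. norm y \<le> \<nu> \<longrightarrow>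
      (\<integral>\<^sup>+x. ennreal ((norm (F (cplx2 x y) + G (cplx2 x y)))\<^sup>2 * exp (\<mu> * norm x)) \<partial>lborel) \<le> M"
    by blast
qed

lemma strip_decay_cmult:
  fixes F :: "complex \<times> complex \<Rightarrow> complex"
  assumes F: "strip_decay F"
  shows "strip_decay (\<lambda>z. c * F z)"
  unfolding strip_decay_def
proof (intro conjI allI)
  note [measurable] = strip_decay_entire2[OF F]
  show "entire2 (\<lambda>z. c * F z)"
    using F by (intro entire2_mult entire2_const strip_decay_entire2)
  fix \<mu> \<nu>
  obtain M where M: "0 \<le> M" "\<And>y. norm y \<le> \<nu> \<Longrightarrow>
      (\<integral>\<^sup>+x. ennreal ((norm (F (cplx2 x y)))\<^sup>2 * exp (\<mu> * norm x)) \<partial>lborel) \<le> ennreal M"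
    using strip_decayE[OF F] by blast
  have "(\<integral>\<^sup>+x. ennreal ((norm (c * F (cplx2 x y)))\<^sup>2 * exp (\<mu> * norm x)) \<partial>lborel)
      \<le> ennreal ((norm c)\<^sup>2 * M)" if y: "norm y \<le> \<nu>" for y
  proof -
    have "(\<integral>\<^sup>+x. ennreal ((norm (c * F (cplx2 x y)))\<^sup>2 * exp (\<mu> * norm x)) \<partial>lborel)
      = (\<integral>\<^sup>+x. ennreal ((norm c)\<^sup>2) * ennreal ((norm (F (cplx2 x y)))\<^sup>2 * exp (\<mu> * norm x)) \<partial>lborel)"
      by (simp add: norm_mult power_mult_distrib mult.assoc flip: ennreal_mult)
    also have "\<dots> = ennreal ((norm c)\<^sup>2) * (\<integral>\<^sup>+x. ennreal ((norm (F (cplx2 x y)))\<^sup>2 * exp (\<mu> * norm x)) \<partial>lborel)"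
      by (rule nn_integral_cmult) measurable
    also have "\<dots> \<le> ennreal ((norm c)\<^sup>2) * ennreal M"
      by (intro mult_left_mono M y) simp
    finally show ?thesis using M by (simp add: ennreal_mult)
  qed
  then show "\<exists>M::real. \<forall>y. norm y \<le> \<nu> \<longrightarrow>
      (\<integral>\<^sup>+x. ennreal ((norm (c * F (cplx2 x y)))\<^sup>2 * exp (\<mu> * norm x)) \<partial>lborel) \<le> M"
    by blast
qed

section \<open>From weighted square bounds to integrable slices\<close>

lemma strip_integrable_mult:
  fixes F G :: "complex \<times> complex \<Rightarrow> complex"
  assumes F: "strip_decay F" and G: "strip_decay G"
  shows "strip_integrable (\<lambda>z. F z * G z)"
  unfolding strip_integrable_def
proof (intro conjI allI)
  note [measurable] = strip_decay_entire2[OF F] strip_decay_entire2[OF G]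
  show "entire2 (\<lambda>z. F z * G z)"
    using F G by (intro entire2_mult strip_decay_entire2)
  fix \<nu>
  obtain M where M: "0 \<le> M" "\<And>y. norm y \<le> \<nu> \<Longrightarrow>
      (\<integral>\<^sup>+x. ennreal ((norm (F (cplx2 x y)))\<^sup>2 * exp (0 * norm x)) \<partial>lborel) \<le> ennreal M"
    using strip_decayE[OF F] by blast
  obtain N where N: "0 \<le> N" "\<And>y. norm y \<le> \<nu> \<Longrightarrow>
      (\<integral>\<^sup>+x. ennreal ((norm (G (cplx2 x y)))\<^sup>2 * exp (0 * norm x)) \<partial>lborel) \<le> ennreal N"
    using strip_decayE[OF G] by blast
  have "(\<integral>\<^sup>+x. norm (F (cplx2 x y) * G (cplx2 x y)) \<partial>lborel) \<le> ennreal (M + N)" if y: "norm y \<le> \<nu>" for y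
  proof -
    have le: "norm (p * q) \<le> (norm p)\<^sup>2 + (norm q)\<^sup>2" for p q :: complex
      using sum_squares_bound[of "norm p" "norm q"] zero_le_power2[of "norm p"] zero_le_power2[of "norm q"]
      by (simp only: norm_mult)
    have "(\<integral>\<^sup>+x. norm (F (cplx2 x y) * G (cplx2 x y)) \<partial>lborel)
       \<le> (\<integral>\<^sup>+x. ennreal ((norm (F (cplx2 x y)))\<^sup>2) + ennreal ((norm (G (cplx2 x y)))\<^sup>2) \<partial>lborel)"
      by (intro nn_integral_mono) (use le in \<open>simp flip: ennreal_plus\<close>)
    also have "\<dots> = (\<integral>\<^sup>+x. ennreal ((norm (F (cplx2 x y)))\<^sup>2) \<partial>lborel) + (\<integral>\<^sup>+x. ennreal ((norm (G (cplx2 x y)))\<^sup>2) \<partial>lborel)"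
      by (rule nn_integral_add) measurable
    also have "\<dots> \<le> ennreal M + ennreal N"
      using M(2)[OF y] N(2)[OF y] by (intro add_mono) simp_all
    finally show ?thesis using M N by simp
  qed
  then show "\<exists>M::real. \<forall>y. norm y \<le> \<nu> \<longrightarrow> (\<integral>\<^sup>+x. norm (F (cplx2 x y) * G (cplx2 x y)) \<partial>lborel) \<le> M"
    by blast
qed

text \<open>Twice the Euclidean norm dominates the sum of the absolute coordinates, so a product of
  one-dimensional two-sided exponentials is an integrable majorant.\<close>

lemma integrable_exp_neg_norm: "integrable lborel (\<lambda>x :: real \<times> real. exp (- 2 * norm x))"
proof -
  have half: "(\<integral>\<^sup>+t. ennreal (exp (- t)) * indicator {0..} t \<partial>lborel) = 1"
    using nn_intergal_power_times_exp_Ici[of 0] by simp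
  have "(\<integral>\<^sup>+t. ennreal (exp t) * indicator {..0} t \<partial>lborel)
      = (\<integral>\<^sup>+t. ennreal (exp (- t)) * indicator {0..} t \<partial>lborel)"
    by (subst nn_integral_real_affine[where c = "-1" and t = 0])
      (auto intro!: nn_integral_cong split: split_indicator)
  then have "(\<integral>\<^sup>+t. ennreal (exp (- t)) * indicator {0..} t + ennreal (exp t) * indicator {..0} t \<partial>lborel) = 2"
    by (subst nn_integral_add) (simp_all add: half)
  moreover have "(\<integral>\<^sup>+t. ennreal (exp (- \<bar>t\<bar>)) \<partial>lborel)
    \<le> (\<integral>\<^sup>+t. ennreal (exp (- t)) * indicator {0..} t + ennreal (exp t) * indicator {..0} t \<partial>lborel)"
    by (intro nn_integral_mono) (auto split: split_indicator)
  ultimately have "(\<integral>\<^sup>+t. ennreal (exp (- \<bar>t\<bar>)) \<partial>(lborel :: real measure)) < \<infinity>"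
    by (simp add: le_less_trans)
  then have int1: "integrable lborel (\<lambda>t::real. exp (- \<bar>t\<bar>))"
    by (intro integrableI_bounded) auto
  have "integrable (lborel \<Otimes>\<^sub>M lborel) (\<lambda>(s::real, t::real). exp (- \<bar>s\<bar>) * exp (- \<bar>t\<bar>))"
    by (rule lborel_pair.Fubini_integrable) (use int1 in auto)
  then have "integrable lborel (\<lambda>(s::real, t::real). exp (- \<bar>s\<bar>) * exp (- \<bar>t\<bar>))"
    by (simp add: lborel_prod)
  then show ?thesis
  proof (rule Bochner_Integration.integrable_bound, goal_cases)
    case 2
    have "exp (- 2 * norm x) \<le> exp (- \<bar>fst x\<bar>) * exp (- \<bar>snd x\<bar>)" for x :: "real \<times> real"
      using abs_fst_le_norm[of x] abs_snd_le_norm[of x] by (simp flip: exp_add)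
    then show ?case by (simp add: case_prod_unfold)
  qed simp
qed

text \<open>Split \<open>norm F\<close> as \<open>(norm F * exp (norm x)) * exp (- norm x)\<close>
  and bound the product by the sum of squares. Weight 2 controls the first square, and the second is
  integrable on the plane.\<close>

lemma strip_decay_integrable:
  fixes F :: "complex \<times> complex \<Rightarrow> complex"
  assumes F: "strip_decay F"
  shows "strip_integrable F"
  unfolding strip_integrable_def
proof (intro conjI allI)
  note [measurable] = strip_decay_entire2[OF F]
  show "entire2 F"
    using F by (rule strip_decay_entire2)
  fix \<nu>
  obtain M where M: "0 \<le> M" "\<And>y. norm y \<le> \<nu> \<Longrightarrow>
      (\<integral>\<^sup>+x. ennreal ((norm (F (cplx2 x y)))\<^sup>2 * exp (2 * norm x)) \<partial>lborel) \<le> ennreal M"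
    using strip_decayE[OF F] by blast
  define N where "N = (LINT x|lborel. exp (- 2 * norm (x :: real \<times> real)))"
  have N: "0 \<le> N" "(\<integral>\<^sup>+x. ennreal (exp (- 2 * norm (x :: real \<times> real))) \<partial>lborel) = ennreal N"
    unfolding N_def using nn_integral_eq_integral[OF integrable_exp_neg_norm] by simp_all
  have "(\<integral>\<^sup>+x. norm (F (cplx2 x y)) \<partial>lborel) \<le> ennreal (M + N)" if y: "norm y \<le> \<nu>" for y
  proof -
    have le: "norm (F (cplx2 x y)) \<le> (norm (F (cplx2 x y)))\<^sup>2 * exp (2 * norm x) + exp (- 2 * norm x)" for x
    proof -
      have "norm (F (cplx2 x y)) = (norm (F (cplx2 x y)) * exp (norm x)) * exp (- norm x)"
        by (simp add: exp_minus)
      also have "\<dots> \<le> (norm (F (cplx2 x y)) * exp (norm x))\<^sup>2 + (exp (- norm x))\<^sup>2"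
      proof -
        have "0 \<le> norm (F (cplx2 x y)) * exp (norm x) * exp (- norm x)" by simp
        then show ?thesis
          using sum_squares_bound[of "norm (F (cplx2 x y)) * exp (norm x)" "exp (- norm x)"] by linarith
      qed
      also have "\<dots> = (norm (F (cplx2 x y)))\<^sup>2 * exp (2 * norm x) + exp (- 2 * norm x)"
        using exp_double[of "norm x"] exp_double[of "- norm x"] by (simp add: power_mult_distrib)
      finally show ?thesis .
    qed
    have "(\<integral>\<^sup>+x. norm (F (cplx2 x y)) \<partial>lborel)
       \<le> (\<integral>\<^sup>+x. ennreal ((norm (F (cplx2 x y)))\<^sup>2 * exp (2 * norm x)) + ennreal (exp (- 2 * norm x)) \<partial>lborel)"
      by (intro nn_integral_mono) (use le in \<open>simp flip: ennreal_plus\<close>)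
    also have "\<dots> = (\<integral>\<^sup>+x. ennreal ((norm (F (cplx2 x y)))\<^sup>2 * exp (2 * norm x)) \<partial>lborel) + ennreal N"
      unfolding N(2)[symmetric] by (rule nn_integral_add) measurable
    also have "\<dots> \<le> ennreal M + ennreal N"
      by (intro add_mono M y order_refl)
    finally show ?thesis using M N by simp
  qed
  then show "\<exists>M::real. \<forall>y. norm y \<le> \<nu> \<longrightarrow> (\<integral>\<^sup>+x. norm (F (cplx2 x y)) \<partial>lborel) \<le> M"
    by blast
qed

lemma entire2_star:
  assumes "entire2 F"
  shows "entire2 (\<lambda>(z1, z2). cnj (F (cnj z1, cnj z2)))"
  unfolding entire2_def case_prod_unfold
proof
  fix w :: "complex \<times> complex"
  obtain c1 c2 where d: "(F has_derivative (\<lambda>h. c1 * fst h + c2 * snd h)) (at (cnj (fst w), cnj (snd w)))"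
    using assms unfolding entire2_def by meson
  have "((\<lambda>z. (cnj (fst z), cnj (snd z))) has_derivative (\<lambda>h. (cnj (fst h), cnj (snd h)))) (at w)"
    by (auto intro!: derivative_eq_intros)
  from has_derivative_cnj[OF has_derivative_compose[OF this d]]
  show "\<exists>c1 c2. ((\<lambda>z. cnj (F (cnj (fst z), cnj (snd z)))) has_derivative (\<lambda>h. c1 * fst h + c2 * snd h)) (at w)"
    by (intro exI[of _ "cnj c1"] exI[of _ "cnj c2"]) simp
qed

text \<open>Conjugation sends level \<open>y\<close> to level \<open>- y\<close>, and the bounds
  depend on \<open>norm y\<close> only.\<close>

lemma strip_decay_star:
  fixes F :: "complex \<times> complex \<Rightarrow> complex"
  assumes F: "strip_decay F"
  shows "strip_decay (\<lambda>(z1, z2). cnj (F (cnj z1, cnj z2)))"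
  unfolding strip_decay_def
proof (intro conjI allI)
  show "entire2 (\<lambda>(z1, z2). cnj (F (cnj z1, cnj z2)))"
    by (rule entire2_star[OF strip_decay_entire2[OF F]])
  fix \<mu> \<nu>
  obtain M where M: "\<And>y. norm y \<le> \<nu> \<Longrightarrow>
      (\<integral>\<^sup>+x. ennreal ((norm (F (cplx2 x y)))\<^sup>2 * exp (\<mu> * norm x)) \<partial>lborel) \<le> ennreal M"
    using strip_decayE[OF F] by blast
  have cnj: "(case cplx2 x y of (z1, z2) \<Rightarrow> cnj (F (cnj z1, cnj z2))) = cnj (F (cplx2 x (- y)))" for x y
    by (simp add: cplx2_def complex_cnj)
  have "(\<integral>\<^sup>+x. ennreal ((norm (cnj (F (cplx2 x (- y)))))\<^sup>2 * exp (\<mu> * norm x)) \<partial>lborel) \<le> M"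
    if "norm y \<le> \<nu>" for y
    using M[of "- y"] that by simp
  then show "\<exists>M::real. \<forall>y. norm y \<le> \<nu> \<longrightarrow>
      (\<integral>\<^sup>+x. ennreal ((norm (case cplx2 x y of (z1, z2) \<Rightarrow> cnj (F (cnj z1, cnj z2))))\<^sup>2 * exp (\<mu> * norm x)) \<partial>lborel) \<le> M"
    unfolding cnj by blast
qed

section \<open>The exponential functional of a twisted product\<close>

lemma strip_decay_lborel_integrable:
  "strip_decay F \<Longrightarrow> integrable lborel (\<lambda>x. F (cplx2 x y))"
  by (rule strip_integrable_integrable[OF strip_decay_integrable])

text \<open>The phase extends to an entire exponential, so the whole integrand keeps an integral
  independent of the level. At level \<open>y\<close> the extended phase is the original one times
  \<open>exp (- 4 * pi * (y \<bullet> rot s))\<close>.\<close>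

lemma strip_symplectic_ft_shift:
  fixes F :: "complex \<times> complex \<Rightarrow> complex"
  assumes F: "strip_decay F"
  shows "symplectic_ft (\<lambda>x. F (cplx2 x 0)) s
       = exp (- 4 * pi * (y \<bullet> rot s)) * symplectic_ft (\<lambda>x. F (cplx2 x y)) s"
proof -
  define G where "G z = F z * exp (\<i> * (4 * pi * snd s) * fst z + (- \<i> * (4 * pi * fst s)) * snd z)" for z
  have G: "G (cplx2 x y) = exp (- 4 * pi * (y \<bullet> rot s)) * (F (cplx2 x y) * cis (4 * pi * (x \<bullet> rot s)))" for x y
  proof -
    have "\<i> * (4 * pi * snd s) * fst (cplx2 x y) + (- \<i> * (4 * pi * fst s)) * snd (cplx2 x y)
       = complex_of_real (- 4 * pi * (y \<bullet> rot s)) + \<i> * complex_of_real (4 * pi * (x \<bullet> rot s))"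
      by (simp add: cplx2_def rot_def inner_prod_def complex_eq_iff algebra_simps)
    then show ?thesis
      by (simp only: G_def exp_add cis_conv_exp exp_of_real mult_ac)
  qed
  have "strip_integrable G"
    unfolding G_def[abs_def] by (intro strip_decay_integrable strip_decay_mult_exp F)
  from strip_integral_shift[OF this, of y] show ?thesis
    by (simp add: G symplectic_ft_def)
qed

text \<open>The level may depend on \<open>s\<close>. Taking it in the direction of
  \<open>rot s\<close>, with length \<open>c / (4 * pi)\<close>, makes the shift factor equal to
  \<open>exp (- c * norm s)\<close>, while the slice integrals stay bounded uniformly in
  \<open>s\<close>.\<close>

lemma strip_symplectic_ft_bound:
  fixes F :: "complex \<times> complex \<Rightarrow> complex"
  assumes F: "strip_decay F" and c: "0 \<le> c"
  obtains M where "\<And>s. norm (symplectic_ft (\<lambda>x. F (cplx2 x 0)) s) \<le> M * exp (- c * norm s)"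
proof -
  note [measurable] = strip_decay_entire2[OF F]
  obtain M :: real where M: "\<And>y. norm y \<le> c / (4 * pi) \<Longrightarrow> (\<integral>\<^sup>+x. norm (F (cplx2 x y)) \<partial>lborel) \<le> M"
    using strip_decay_integrable[OF F] unfolding strip_integrable_def by meson
  have "norm (symplectic_ft (\<lambda>x. F (cplx2 x 0)) s) \<le> max 0 M * exp (- c * norm s)" for s
  proof -
    \<comment> \<open>For \<open>s = 0\<close> the division by zero yields \<open>y = 0\<close>, and
      both claims about \<open>y\<close> still hold.\<close>
    define y where "y = (c / (4 * pi) / norm s) *\<^sub>R rot s"
    have y: "norm y \<le> c / (4 * pi)" "4 * pi * (y \<bullet> rot s) = c * norm s"
      using c by (auto simp: y_def dot_square_norm power2_eq_square)
    have "ennreal (norm (symplectic_ft (\<lambda>x. F (cplx2 x y)) s)) \<le> (\<integral>\<^sup>+x. norm (F (cplx2 x y) * cis (4 * pi * (x \<bullet> rot s))) \<partial>lborel)"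
    proof -
      have "integrable lborel (\<lambda>x. F (cplx2 x y) * cis (4 * pi * (x \<bullet> rot s)))"
        by (rule Bochner_Integration.integrable_bound[OF strip_decay_lborel_integrable[OF F, of y]])
          (measurable, simp add: norm_mult)
      then show ?thesis
        unfolding symplectic_ft_def by (rule integral_norm_bound_ennreal)
    qed
    also have "\<dots> \<le> ennreal M" using M[OF y(1)] by (simp add: norm_mult)
    finally have "norm (symplectic_ft (\<lambda>x. F (cplx2 x y)) s) \<le> max 0 M"
      by (auto simp: ennreal_le_iff2)
    then show ?thesis
      unfolding strip_symplectic_ft_shift[OF F, of s y]
      using y(2) by (simp add: norm_mult mult.commute mult_right_mono)
  qed
  then show thesis by (rule that)
qed

text \<open>The weighted transform is itself the transform of the slice at level
  \<open>(1/2) *\<^sub>R rot A\<close>, since \<open>rot\<close> is orthogonal and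
  \<open>4 * pi\<close> times one half is \<open>2 * pi\<close>. Inversion is applied to that
  slice.\<close>

lemma strip_symplectic_inversion:
  fixes F :: "complex \<times> complex \<Rightarrow> complex"
  assumes F: "strip_decay F"
  shows "integrable lborel (\<lambda>s. exp (2 * pi * (A \<bullet> s)) * symplectic_ft (\<lambda>x. F (cplx2 x 0)) s)"
    and "AE u in lborel. 4 * (LINT s|lborel. exp (2 * pi * (A \<bullet> s)) * symplectic_ft (\<lambda>x. F (cplx2 x 0)) s *
        cis (4 * pi * (s \<bullet> rot u))) = F (cplx2 u ((1/2) *\<^sub>R rot A))"
proof -
  note [measurable] = strip_decay_entire2[OF F]
  let ?a = "symplectic_ft (\<lambda>x. F (cplx2 x 0))"
  \<comment> \<open>The rate \<open>2 * pi * norm A\<close> cancels the growth of the weight; the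
    extra 2 leaves the majorant \<open>exp (- 2 * norm s)\<close>.\<close>
  obtain M where M: "\<And>s. norm (?a s) \<le> M * exp (- (2 * pi * norm A + 2) * norm s)"
    using strip_symplectic_ft_bound[OF F, of "2 * pi * norm A + 2"] by fastforce
  show int: "integrable lborel (\<lambda>s. exp (2 * pi * (A \<bullet> s)) * ?a s)"
  proof (rule Bochner_Integration.integrable_bound[where f = "\<lambda>s. M * exp (- 2 * norm s)"])
    show "integrable lborel (\<lambda>s :: real \<times> real. M * exp (- 2 * norm s))"
      by (intro integrable_mult_right integrable_exp_neg_norm)
    show "AE s in lborel. norm (exp (2 * pi * (A \<bullet> s)) * ?a s) \<le> norm (M * exp (- 2 * norm s))"
    proof (rule AE_I2)
      fix s
      have "norm (exp (2 * pi * (A \<bullet> s)) * ?a s) = exp (2 * pi * (A \<bullet> s)) * norm (?a s)"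
        by (simp add: norm_mult)
      also have "\<dots> \<le> exp (2 * pi * (norm A * norm s)) * (M * exp (- (2 * pi * norm A + 2) * norm s))"
        by (intro mult_mono M) (auto intro: norm_cauchy_schwarz)
      also have "\<dots> = M * (exp (2 * pi * (norm A * norm s)) * exp (- (2 * pi * norm A + 2) * norm s))"
        by simp
      also have "\<dots> = M * exp (- 2 * norm s)"
        by (simp add: algebra_simps flip: exp_add)
      finally show "norm (exp (2 * pi * (A \<bullet> s)) * ?a s) \<le> norm (M * exp (- 2 * norm s))"
        by (simp only: real_norm_def abs_ge_self order_trans[OF _ abs_ge_self])
    qed
  qed measurable
  let ?y = "(1/2) *\<^sub>R rot A"
  have ft: "symplectic_ft (\<lambda>x. F (cplx2 x ?y)) = (\<lambda>s. exp (2 * pi * (A \<bullet> s)) * ?a s)"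
    using strip_symplectic_ft_shift[OF F, of _ ?y]
    by (auto simp: fun_eq_iff mult.assoc[symmetric] simp flip: of_real_mult exp_add)
  have "continuous_on UNIV (\<lambda>x. F (cplx2 x ?y))"
    by (rule continuous_on_compose2[OF entire2_continuous[OF strip_decay_entire2[OF F]]])
      (auto simp: cplx2_def intro!: continuous_intros)
  from symplectic_ft_inversion[OF strip_decay_lborel_integrable[OF F] this] int
  show "AE u in lborel. 4 * (LINT s|lborel. exp (2 * pi * (A \<bullet> s)) * ?a s *
        cis (4 * pi * (s \<bullet> rot u))) = F (cplx2 u ?y)"
    unfolding ft by blast
qed

text \<open>The phase is the symplectic form of \<open>x - u\<close> and \<open>x - v\<close>. By
  bilinearity and skew-symmetry it splits into a part without \<open>v\<close> and the form of
  \<open>v\<close> and \<open>x - u\<close>, so the \<open>v\<close>-integral is a transform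
  evaluated at \<open>x - u\<close>.\<close>

lemma twisted_prod_eq:
  assumes c: "integrable lborel c" and a: "integrable lborel a"
  shows "twisted_prod c a x = 4 * (LINT u|lborel. c u * cis (4 * pi * (x \<bullet> rot u)) * symplectic_ft a (x - u))"
proof -
  have [measurable]: "c \<in> borel_measurable borel" "a \<in> borel_measurable borel"
    using c a by auto
  let ?K = "\<lambda>(u, v). c u * a v * cis (4 * pi * (x \<bullet> rot u + v \<bullet> rot (x - u)))"
  have ph: "exp (4 * complex_of_real pi * \<i> * complex_of_real ((fst x - fst u) * (snd x - snd v) - (fst x - fst v) * (snd x - snd u)))
     = cis (4 * pi * (x \<bullet> rot u + v \<bullet> rot (x - u)))" for u v
  proof -
    have "(fst x - fst u) * (snd x - snd v) - (fst x - fst v) * (snd x - snd u) = x \<bullet> rot u + v \<bullet> rot (x - u)"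
      by (simp add: rot_def inner_prod_def algebra_simps)
    then show ?thesis by (simp add: cis_conv_exp mult_ac)
  qed
  have int: "integrable (lborel \<Otimes>\<^sub>M lborel) ?K"
  proof (rule lborel_pair.Fubini_integrable)
    show "integrable lborel (\<lambda>u. LINT v|lborel. norm (?K (u, v)))"
      using c a by (simp add: norm_mult)
    show "AE u in lborel. integrable lborel (\<lambda>v. ?K (u, v))"
    proof (rule AE_I2)
      fix u
      have "integrable lborel (\<lambda>v. norm (c u) * norm (a v))" using a by simp
      then show "integrable lborel (\<lambda>v. ?K (u, v))"
        unfolding prod.case
        by (rule Bochner_Integration.integrable_bound) (measurable, simp add: norm_mult)
    qed
  qed measurable
  have "twisted_prod c a x = 4 * (LINT p|lborel. ?K p)"
    unfolding twisted_prod_def case_prod_unfold ph prod.collapse ..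
  also have "(LINT p|lborel. ?K p) = (LINT u|lborel. LINT v|lborel. ?K (u, v))"
    using lborel_pair.integral_fst'[OF int] by (simp add: lborel_prod)
  also have "\<dots> = (LINT u|lborel. c u * cis (4 * pi * (x \<bullet> rot u)) * symplectic_ft a (x - u))"
    unfolding symplectic_ft_def integral_mult_right_zero[symmetric]
    by (simp add: distrib_left cis_mult[symmetric] mult_ac)
  finally show ?thesis .
qed

text \<open>The weight is multiplicative, so after the translation \<open>x = u + s\<close> one
  factor goes to \<open>c\<close> and the other to the transform of \<open>a\<close>. Both weighted
  functions are integrable, which justifies the exchange of the integrals over \<open>u\<close> and
  \<open>x\<close>.\<close>

lemma exp_functional_twisted_prod:
  fixes C F :: "complex \<times> complex \<Rightarrow> complex"
  assumes C: "strip_decay C" and F: "strip_decay F"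
  shows "(LINT x|lborel. exp (2 * pi * (A \<bullet> x)) * twisted_prod (\<lambda>x. C (cplx2 x 0)) (\<lambda>x. F (cplx2 x 0)) x)
       = (LINT u|lborel. exp (2 * pi * (A \<bullet> u)) * C (cplx2 u 0) * F (cplx2 u ((1/2) *\<^sub>R rot A)))"
proof -
  note [measurable] = strip_decay_entire2[OF F] strip_decay_entire2[OF C]
  let ?c = "\<lambda>x. C (cplx2 x 0)"
  let ?a = "symplectic_ft (\<lambda>x. F (cplx2 x 0))"
  define e where "e x = complex_of_real (exp (2 * pi * (A \<bullet> x)))" for x
  have [measurable]: "e \<in> borel_measurable borel" unfolding e_def[abs_def] by measurable
  have e_add: "e (u + s) = e u * e s" for u s
    by (simp add: e_def inner_add_right distrib_left exp_add)
  let ?K = "\<lambda>u x. e x * (?c u * cis (4 * pi * (x \<bullet> rot u)) * ?a (x - u))"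
  let ?L = "\<lambda>u s. e u * ?c u * (e s * ?a s * cis (4 * pi * (s \<bullet> rot u)))"
  \<comment> \<open>The phase loses its \<open>u\<close>-part because the symplectic form vanishes
    on \<open>(u, u)\<close>.\<close>
  have KL: "?K u (u + s) = ?L u s" for u s
    by (simp add: e_add inner_add_left)
  have ec: "integrable lborel (\<lambda>u. e u * ?c u)"
  proof -
    have "integrable lborel (\<lambda>u. C (cplx2 u 0) * exp (2 * pi * fst A * fst (cplx2 u 0) + 2 * pi * snd A * snd (cplx2 u 0)))"
      by (rule strip_decay_lborel_integrable[OF strip_decay_mult_exp[OF C]])
    moreover have "exp (2 * pi * fst A * fst (cplx2 u 0) + 2 * pi * snd A * snd (cplx2 u 0)) = e u" for u
      by (simp add: e_def cplx2_def inner_prod_def Complex_eq distrib_left mult.assoc flip: exp_of_real)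
    ultimately show ?thesis by (simp add: mult.commute)
  qed
  have ea: "integrable lborel (\<lambda>s. e s * ?a s)"
    unfolding e_def by (rule strip_symplectic_inversion(1)[OF F])
  have K_int: "integrable lborel (?K u)" for u
  proof -
    have "integrable lborel (\<lambda>s. (e u * ?c u) * (e s * ?a s))" using ea by simp
    then have "integrable lborel (?L u)"
      by (rule Bochner_Integration.integrable_bound) (measurable, simp add: norm_mult)
    then have "integrable lborel (\<lambda>s. ?K u (u + 1 *\<^sub>R s))" unfolding scaleR_one KL .
    then show ?thesis
      by (subst (asm) lborel_integrable_affine) (auto simp del: scaleR_one)
  qed
  have K_trans: "(LINT x|lborel. ?K u x) = (LINT s|lborel. ?L u s)" for u
    using lborel_integral_affine[of 1 "?K u" u] unfolding scaleR_one KL by simp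
  have K_norm: "(LINT x|lborel. norm (?K u x)) = norm (e u * ?c u) * (LINT s|lborel. norm (e s * ?a s))" for u
  proof -
    have "(LINT x|lborel. norm (?K u x)) = (LINT s|lborel. norm (?K u (u + s)))"
      using lborel_integral_affine[of 1 "\<lambda>x. norm (?K u x)" u] by simp
    also have "\<dots> = (LINT s|lborel. norm (e u * ?c u) * norm (e s * ?a s))"
      unfolding KL by (simp add: norm_mult)
    finally show ?thesis by simp
  qed
  have int: "integrable (lborel \<Otimes>\<^sub>M lborel) (\<lambda>(u, x). ?K u x)"
  proof (rule lborel_pair.Fubini_integrable)
    show "integrable lborel (\<lambda>u. LINT x|lborel. norm (case (u, x) of (u, x) \<Rightarrow> ?K u x))"
      unfolding prod.case K_norm using ec by (intro integrable_mult_left integrable_norm)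
    show "AE u in lborel. integrable lborel (\<lambda>x. case (u, x) of (u, x) \<Rightarrow> ?K u x)"
      unfolding prod.case by (intro AE_I2 K_int)
  qed measurable
  have "(LINT x|lborel. e x * twisted_prod ?c (\<lambda>x. F (cplx2 x 0)) x)
      = 4 * (LINT x|lborel. LINT u|lborel. ?K u x)"
    unfolding twisted_prod_eq[OF strip_decay_lborel_integrable[OF C] strip_decay_lborel_integrable[OF F]]
      integral_mult_right_zero[symmetric]
    by (simp add: mult.left_commute)
  also have "(LINT x|lborel. LINT u|lborel. ?K u x) = (LINT u|lborel. LINT x|lborel. ?K u x)"
    by (rule lborel_pair.Fubini_integral[OF int])
  also have "4 * \<dots> = (LINT u|lborel. e u * ?c u * (4 * (LINT s|lborel. e s * ?a s * cis (4 * pi * (s \<bullet> rot u)))))"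
    unfolding K_trans integral_mult_right_zero[symmetric]
    by (simp add: mult_ac)
  also have "\<dots> = (LINT u|lborel. e u * ?c u * F (cplx2 u ((1/2) *\<^sub>R rot A)))"
  proof (rule integral_cong_AE)
    show "AE u in lborel. e u * ?c u * (4 * (LINT s|lborel. e s * ?a s * cis (4 * pi * (s \<bullet> rot u))))
        = e u * ?c u * F (cplx2 u ((1/2) *\<^sub>R rot A))"
      using strip_symplectic_inversion(2)[OF F, of A] by eventually_elim (simp add: e_def)
  qed measurable
  finally show ?thesis by (simp add: e_def)
qed

lemma exp_functional_twisted_prod_symmetric:
  fixes C F :: "complex \<times> complex \<Rightarrow> complex"
  assumes C: "strip_decay C" and F: "strip_decay F"
  shows "(LINT x|lborel. exp (2 * pi * (A \<bullet> x)) * twisted_prod (\<lambda>x. C (cplx2 x 0)) (\<lambda>x. F (cplx2 x 0)) x)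
       = (LINT u|lborel. exp (2 * pi * (A \<bullet> u)) * F (cplx2 u ((1/4) *\<^sub>R rot A)) * C (cplx2 u (- (1/4) *\<^sub>R rot A)))"
proof -
  define G where "G z = C z * exp (2 * pi * fst A * fst z + 2 * pi * snd A * snd z) * F (z + cplx2 0 ((1/2) *\<^sub>R rot A))" for z :: "complex \<times> complex"
  have "strip_integrable G"
    unfolding G_def[abs_def] by (intro strip_integrable_mult strip_decay_mult_exp strip_decay_shift C F)
  note shift = strip_integral_shift[OF this, of "- (1/4) *\<^sub>R rot A"]
  \<comment> \<open>Since \<open>rot A\<close> is orthogonal to \<open>A\<close>, moving along
    multiples of \<open>rot A\<close> leaves the weight unchanged; only the arguments of
    \<open>C\<close> and \<open>F\<close> feel the shift.\<close>
  have e: "exp (2 * pi * fst A * fst (cplx2 u (t *\<^sub>R rot A)) + 2 * pi * snd A * snd (cplx2 u (t *\<^sub>R rot A)))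
     = complex_of_real (exp (2 * pi * (A \<bullet> u)))" for u t
  proof -
    have "2 * pi * fst A * fst (cplx2 u (t *\<^sub>R rot A)) + 2 * pi * snd A * snd (cplx2 u (t *\<^sub>R rot A))
      = complex_of_real (2 * pi * (A \<bullet> u))"
      by (simp add: cplx2_def rot_def inner_prod_def complex_eq_iff algebra_simps)
    then show ?thesis by (simp only: exp_of_real)
  qed
  have "G (cplx2 u 0) = exp (2 * pi * (A \<bullet> u)) * C (cplx2 u 0) * F (cplx2 u ((1/2) *\<^sub>R rot A))" for u
    using e[of u 0] by (simp add: G_def flip: cplx2_add)
  moreover have "G (cplx2 u (- (1/4) *\<^sub>R rot A)) = exp (2 * pi * (A \<bullet> u)) * F (cplx2 u ((1/4) *\<^sub>R rot A)) * C (cplx2 u (- (1/4) *\<^sub>R rot A))" for u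
  proof -
    have "cplx2 u (- (1/4) *\<^sub>R rot A) + cplx2 0 ((1/2) *\<^sub>R rot A) = cplx2 u ((1/4) *\<^sub>R rot A)"
      unfolding cplx2_add[symmetric] scaleR_add_left[symmetric] by simp
    then show ?thesis unfolding G_def e by (simp only: mult_ac)
  qed
  ultimately show ?thesis
    unfolding exp_functional_twisted_prod[OF C F] using shift by simp
qed

section \<open>The unitary spaces and the operator\<close>

lemma cplx2_of_real: "cplx2 x 0 = (complex_of_real (fst x), complex_of_real (snd x))"
  by (simp add: cplx2_def complex_eq_iff)

lemma frakA_entire_ext:
  assumes "a \<in> frakA"
  shows "entire_extends (entire_ext a) a" "strip_decay (entire_ext a)" "entire_ext a (cplx2 x 0) = a x"
proof -
  obtain F where F: "entire_extends F a" "strip_decay F" using assms by (auto simp: frakA_iff)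
  then show "entire_extends (entire_ext a) a" "strip_decay (entire_ext a)"
    by (simp_all add: entire_ext_eq)
  then show "entire_ext a (cplx2 x 0) = a x"
    by (cases x) (simp add: entire_extends_def cplx2_of_real)
qed

text \<open>Uniqueness of the entire extension lets every later operation on \<open>frakA\<close> be
  carried out on the extensions and then restricted to the real plane.\<close>

lemma frakA_restrictI:
  assumes "strip_decay F"
  shows "(\<lambda>x. F (cplx2 x 0)) \<in> frakA" "entire_ext (\<lambda>x. F (cplx2 x 0)) = F"
proof -
  have F: "entire_extends F (\<lambda>x. F (cplx2 x 0))"
    using assms by (simp add: entire_extends_def strip_decay_def cplx2_of_real)
  then show "(\<lambda>x. F (cplx2 x 0)) \<in> frakA" "entire_ext (\<lambda>x. F (cplx2 x 0)) = F"
    using assms by (auto simp: frakA_iff entire_ext_eq)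
qed

lemma
  assumes "a \<in> frakA" "b \<in> frakA"
  shows frakA_add: "a + b \<in> frakA"
    and entire_ext_add: "entire_ext (a + b) = (\<lambda>z. entire_ext a z + entire_ext b z)"
proof -
  have "(\<lambda>x. entire_ext a (cplx2 x 0) + entire_ext b (cplx2 x 0)) = a + b"
    using assms by (simp add: frakA_entire_ext fun_eq_iff)
  then show "a + b \<in> frakA" "entire_ext (a + b) = (\<lambda>z. entire_ext a z + entire_ext b z)"
    using frakA_restrictI[OF strip_decay_add[OF frakA_entire_ext(2)[OF assms(1)] frakA_entire_ext(2)[OF assms(2)]]]
    by simp_all
qed

lemma
  assumes "a \<in> frakA"
  shows frakA_scale: "fun_scale c a \<in> frakA"
    and entire_ext_scale: "entire_ext (fun_scale c a) = (\<lambda>z. c * entire_ext a z)"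
proof -
  have "(\<lambda>x. c * entire_ext a (cplx2 x 0)) = fun_scale c a"
    using assms by (simp add: frakA_entire_ext fun_eq_iff fun_scale_def)
  then show "fun_scale c a \<in> frakA" "entire_ext (fun_scale c a) = (\<lambda>z. c * entire_ext a z)"
    using frakA_restrictI[OF strip_decay_cmult[OF frakA_entire_ext(2)[OF assms]], of c]
    by simp_all
qed

lemma frakA_star:
  assumes "a \<in> frakA"
  shows "star a \<in> frakA" "entire_ext (star a) = (\<lambda>(z1, z2). cnj (entire_ext a (cnj z1, cnj z2)))"
proof -
  let ?S = "\<lambda>(z1, z2). cnj (entire_ext a (cnj z1, cnj z2))"
  have "?S (cplx2 x 0) = star a x" for x
    using frakA_entire_ext(3)[OF assms, of x] by (simp add: star_def cplx2_of_real)
  then have "(\<lambda>x. ?S (cplx2 x 0)) = star a" by (rule ext)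
  then show "star a \<in> frakA" "entire_ext (star a) = ?S"
    using frakA_restrictI[OF strip_decay_star[OF frakA_entire_ext(2)[OF assms]]] by simp_all
qed

lemma entire_ext_star_cplx2:
  assumes "a \<in> frakA"
  shows "entire_ext (star a) (cplx2 x y) = cnj (entire_ext a (cplx2 x (- y)))"
  unfolding frakA_star(2)[OF assms] by (simp add: cplx2_def complex_cnj)

lemma subspace_frakA: "module.subspace fun_scale frakA"
proof -
  interpret vector_space "fun_scale :: complex \<Rightarrow> (real \<times> real \<Rightarrow> complex) \<Rightarrow> _"
    by (rule vector_space_fun_scale)
  have "strip_decay (\<lambda>z. 0)"
    unfolding strip_decay_def by (auto simp: entire2_const intro: exI[of _ 0])
  then have "0 \<in> frakA"
    using frakA_restrictI(1)[of "\<lambda>z. 0"] by (simp add: zero_fun_def)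
  then show ?thesis
    by (intro subspaceI frakA_add frakA_scale)
qed

text \<open>The set where \<open>a\<close> does not vanish is open and negligible, hence
  empty.\<close>

lemma continuous_AE_zero_imp_zero:
  fixes a :: "'a::euclidean_space \<Rightarrow> complex"
  assumes cont: "continuous_on UNIV a" and ae: "AE x in lborel. a x = 0"
  shows "a x = 0"
proof -
  have op: "open {x. a x \<noteq> 0}"
    using cont by (intro open_Collect_neq continuous_intros)
  have "negligible {x. a x \<noteq> 0}"
  proof -
    have "AE x in lebesgue. a x = 0" using ae by (rule AE_completion)
    then have "{x. a x \<noteq> 0} \<in> null_sets lebesgue"
      using sets_completionI_sets[of _ lborel] borel_open[OF op] by (subst AE_iff_null_sets) auto
    then show ?thesis by (simp add: negligible_iff_null_sets)
  qed
  then have "{x. a x \<noteq> 0} = {}"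
    using op open_not_negligible by blast
  then show ?thesis by blast
qed

lemma frakA_continuous:
  assumes "a \<in> frakA"
  shows "continuous_on UNIV a"
proof -
  have "continuous_on UNIV (\<lambda>x. entire_ext a (cplx2 x 0))"
    by (rule continuous_on_compose2[OF entire2_continuous[OF strip_decay_entire2[OF frakA_entire_ext(2)[OF assms]]]])
      (auto simp: cplx2_def intro!: continuous_intros)
  then show ?thesis using assms by (simp add: frakA_entire_ext)
qed

lemma frakA_l2_integrable:
  assumes "a \<in> frakA" "b \<in> frakA"
  shows "integrable lborel (\<lambda>x. a x * cnj (b x))"
proof -
  have "integrable lborel (\<lambda>x. entire_ext a (cplx2 x 0) * entire_ext (star b) (cplx2 x 0))"
    by (rule strip_integrable_integrable[OF strip_integrable_mult])
      (intro frakA_entire_ext(2) frakA_star(1) assms)+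
  then show ?thesis
    unfolding frakA_entire_ext(3)[OF assms(1)] frakA_entire_ext(3)[OF frakA_star(1)[OF assms(2)]]
    by (simp add: star_def)
qed

text \<open>Definiteness holds for functions and not just for classes modulo null sets, because the
  elements of \<open>frakA\<close> are continuous.\<close>

lemma scalar_product_l2: "scalar_product_on frakA l2_inner"
  unfolding scalar_product_on_def
proof (intro conjI ballI allI impI)
  fix a b c assume "a \<in> frakA" "b \<in> frakA" "c \<in> frakA"
  then show "l2_inner (a + b) c = l2_inner a c + l2_inner b c"
    by (simp add: l2_inner_def distrib_right frakA_l2_integrable)
next
  fix z a c
  show "l2_inner (fun_scale z a) c = z * l2_inner a c"
    by (simp add: l2_inner_def fun_scale_def mult.assoc)
next
  fix a b
  show "l2_inner b a = cnj (l2_inner a b)"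
    unfolding l2_inner_def Bochner_Integration.integral_cnj[symmetric] by (simp add: mult.commute)
next
  fix a assume a: "a \<in> frakA" "a \<noteq> 0"
  have eq: "l2_inner a a = of_real (LINT x|lborel. (norm (a x))\<^sup>2)"
    unfolding l2_inner_def complex_norm_square[symmetric] by (rule integral_complex_of_real)
  then show "l2_inner a a \<in> \<real>" by simp
  have int: "integrable lborel (\<lambda>x. (norm (a x))\<^sup>2)"
    using integrable_norm[OF frakA_l2_integrable[OF a(1) a(1)]] by (simp add: norm_mult power2_eq_square)
  have "(LINT x|lborel. (norm (a x))\<^sup>2) \<noteq> 0"
  proof
    assume "(LINT x|lborel. (norm (a x))\<^sup>2) = 0"
    then have "AE x in lborel. a x = 0"
      by (subst (asm) integral_nonneg_eq_0_iff_AE[OF int]) auto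
    from continuous_AE_zero_imp_zero[OF frakA_continuous[OF a(1)] this]
    have "a = 0" by (simp add: fun_eq_iff)
    with a(2) show False by simp
  qed
  moreover have "(LINT x|lborel. (norm (a x))\<^sup>2) \<ge> 0" by simp
  ultimately show "0 < Re (l2_inner a a)" unfolding eq Re_complex_of_real by linarith
qed

text \<open>There is no circularity: \<open>isometric_linear_iso\<close> asserts only bijectivity,
  linearity and the equality of the two forms. Positivity transfers because \<open>T\<close> is
  linear and injective, so it maps nonzero vectors to nonzero vectors.\<close>

lemma scalar_product_pullback:
  assumes t: "scalar_product_on V t" and sub: "module.subspace fun_scale V"
    and iso: "isometric_linear_iso V s V t T"
  shows "scalar_product_on V s"
proof -
  interpret vector_space "fun_scale :: complex \<Rightarrow> ('a \<Rightarrow> complex) \<Rightarrow> _"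
    by (rule vector_space_fun_scale)
  have add: "\<And>a b. a \<in> V \<Longrightarrow> b \<in> V \<Longrightarrow> T (a + b) = T a + T b"
    and scale: "\<And>z a. a \<in> V \<Longrightarrow> T (fun_scale z a) = fun_scale z (T a)"
    and st: "\<And>a b. a \<in> V \<Longrightarrow> b \<in> V \<Longrightarrow> s a b = t (T a) (T b)"
    and bij: "bij_betw T V V"
    using iso by (auto simp: isometric_linear_iso_def)
  have mem: "\<And>a. a \<in> V \<Longrightarrow> T a \<in> V" using bij_betwE[OF bij] by blast
  have V: "0 \<in> V" "\<And>a b. a \<in> V \<Longrightarrow> b \<in> V \<Longrightarrow> a + b \<in> V" "\<And>z a. a \<in> V \<Longrightarrow> fun_scale z a \<in> V"
    using sub by (auto simp: subspace_0 subspace_add subspace_scale)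
  have "T 0 = 0" using add[OF V(1) V(1)] by simp
  then have nz: "T a \<noteq> 0" if "a \<in> V" "a \<noteq> 0" for a
    using that V(1) bij by (metis bij_betw_imp_inj_on inj_on_eq_iff)
  note t' = t[unfolded scalar_product_on_def]
  have t_add: "t (a + b) c = t a c + t b c" if "a \<in> V" "b \<in> V" "c \<in> V" for a b c
    using t'[THEN conjunct1] that by blast
  have t_scale: "t (fun_scale z a) c = z * t a c" if "a \<in> V" "c \<in> V" for z a c
    using t'[THEN conjunct2, THEN conjunct1] that by blast
  have t_cnj: "t b a = cnj (t a b)" if "a \<in> V" "b \<in> V" for a b
    using t'[THEN conjunct2, THEN conjunct2, THEN conjunct1] that by blast
  have t_pos: "t a a \<in> \<real>" "0 < Re (t a a)" if "a \<in> V" "a \<noteq> 0" for a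
    using t'[THEN conjunct2, THEN conjunct2, THEN conjunct2] that by blast+
  show ?thesis
    unfolding scalar_product_on_def
  proof (intro conjI ballI allI impI)
    show "s b a = cnj (s a b)" if "a \<in> V" "b \<in> V" for a b
      unfolding st[OF that] st[OF that(2,1)] by (rule t_cnj[OF mem mem]) (fact that)+
  qed (simp_all add: st add scale mem V nz t_add t_scale t_pos)
qed

text \<open>Weight and shift are independent parameters here, so that the inverse of an operator of
  this kind is again of this kind, with both signs reversed.\<close>

definition exp_shift :: "real \<times> real \<Rightarrow> real \<times> real \<Rightarrow> (real \<times> real \<Rightarrow> complex) \<Rightarrow> (real \<times> real \<Rightarrow> complex)" where
  "exp_shift A y a = (\<lambda>x. exp (A \<bullet> x) * entire_ext a (cplx2 x y))"

lemma
  assumes a: "a \<in> frakA"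
  shows exp_shift_in_frakA: "exp_shift A y a \<in> frakA"
    and entire_ext_exp_shift: "entire_ext (exp_shift A y a) =
      (\<lambda>z :: complex \<times> complex. entire_ext a (z + cplx2 0 y) * exp (complex_of_real (fst A) * fst z + complex_of_real (snd A) * snd z))"
proof -
  let ?F = "\<lambda>z :: complex \<times> complex. entire_ext a (z + cplx2 0 y) * exp (complex_of_real (fst A) * fst z + complex_of_real (snd A) * snd z)"
  have "exp (complex_of_real (fst A) * fst (cplx2 x 0) + complex_of_real (snd A) * snd (cplx2 x 0)) = complex_of_real (exp (A \<bullet> x))" for x
    by (simp add: cplx2_of_real inner_prod_def exp_of_real[symmetric])
  then have "?F (cplx2 x 0) = exp_shift A y a x" for x
    by (simp add: exp_shift_def flip: cplx2_add)
  then have "(\<lambda>x. ?F (cplx2 x 0)) = exp_shift A y a" by (rule ext)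
  then show "exp_shift A y a \<in> frakA" "entire_ext (exp_shift A y a) = ?F"
    using frakA_restrictI[OF strip_decay_mult_exp[OF strip_decay_shift[OF frakA_entire_ext(2)[OF a]]], of y "fst A" "snd A"]
    by simp_all
qed

text \<open>The second operator evaluates the first weight at level \<open>- y\<close>, which
  produces the extra scalar \<open>exp (- \<i> * (A \<bullet> y))\<close>. Orthogonality makes it
  1.\<close>

lemma exp_shift_inverse:
  assumes a: "a \<in> frakA" and orth: "A \<bullet> y = 0"
  shows "exp_shift (- A) (- y) (exp_shift A y a) = a"
proof
  fix x
  have "complex_of_real (fst A) * fst (cplx2 x (- y)) + complex_of_real (snd A) * snd (cplx2 x (- y)) = complex_of_real (A \<bullet> x)"
    using orth by (simp add: cplx2_def inner_prod_def complex_eq_iff algebra_simps)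
  then have "exp (complex_of_real (fst A) * fst (cplx2 x (- y)) + complex_of_real (snd A) * snd (cplx2 x (- y))) = complex_of_real (exp (A \<bullet> x))"
    by (simp only: exp_of_real)
  moreover have "cplx2 x (- y) + cplx2 0 y = cplx2 x 0"
    by (simp flip: cplx2_add)
  ultimately show "exp_shift (- A) (- y) (exp_shift A y a) x = a x"
    unfolding exp_shift_def[of "- A"] entire_ext_exp_shift[OF a]
    using frakA_entire_ext(3)[OF a, of x]
    by (simp add: mult.left_commute flip: of_real_mult exp_add)
qed

lemma bij_exp_shift:
  assumes "A \<bullet> y = 0"
  shows "bij_betw (exp_shift A y) frakA frakA"
proof (rule bij_betw_byWitness[where f' = "exp_shift (- A) (- y)"])
  show "\<forall>a\<in>frakA. exp_shift (- A) (- y) (exp_shift A y a) = a"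
    using exp_shift_inverse[OF _ assms] by blast
  show "\<forall>a\<in>frakA. exp_shift A y (exp_shift (- A) (- y) a) = a"
    using exp_shift_inverse[of _ "- A" "- y"] assms by simp
qed (use exp_shift_in_frakA in blast)+

lemma T_k_eq:
  "T_k \<alpha> \<beta> k = exp_shift (pi *\<^sub>R (alpha_k \<alpha> \<beta> k, beta_k \<alpha> \<beta> k)) ((1/4) *\<^sub>R rot (alpha_k \<alpha> \<beta> k, beta_k \<alpha> \<beta> k))"
proof (intro ext)
  fix a x
  show "T_k \<alpha> \<beta> k a x = exp_shift (pi *\<^sub>R (alpha_k \<alpha> \<beta> k, beta_k \<alpha> \<beta> k)) ((1/4) *\<^sub>R rot (alpha_k \<alpha> \<beta> k, beta_k \<alpha> \<beta> k)) a x"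
    by (cases x) (simp add: T_k_def exp_shift_def rot_def cplx2_def Complex_eq distrib_left)
qed

lemma form_k_eq:
  fixes \<alpha> \<beta> :: real and k :: "int \<times> int"
  assumes a: "a \<in> frakA" and b: "b \<in> frakA"
  defines "A \<equiv> (alpha_k \<alpha> \<beta> k, beta_k \<alpha> \<beta> k)"
  shows "form_k \<alpha> \<beta> k a b = (LINT x|lborel. exp (2 * pi * (A \<bullet> x)) *
     entire_ext a (cplx2 x ((1/4) *\<^sub>R rot A)) * entire_ext (star b) (cplx2 x (- (1/4) *\<^sub>R rot A)))"
proof -
  have "form_k \<alpha> \<beta> k a b = (LINT x|lborel. exp (2 * pi * (A \<bullet> x)) * twisted_prod (star b) a x)"
    by (simp add: form_k_def h_k_def A_def case_prod_unfold inner_prod_def)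
  also have "\<dots> = (LINT x|lborel. exp (2 * pi * (A \<bullet> x)) *
     twisted_prod (\<lambda>x. entire_ext (star b) (cplx2 x 0)) (\<lambda>x. entire_ext a (cplx2 x 0)) x)"
    by (simp only: frakA_entire_ext(3)[OF a] frakA_entire_ext(3)[OF frakA_star(1)[OF b]])
  also have "\<dots> = (LINT x|lborel. exp (2 * pi * (A \<bullet> x)) *
     entire_ext a (cplx2 x ((1/4) *\<^sub>R rot A)) * entire_ext (star b) (cplx2 x (- (1/4) *\<^sub>R rot A)))"
    by (rule exp_functional_twisted_prod_symmetric[OF frakA_entire_ext(2)[OF frakA_star(1)[OF b]] frakA_entire_ext(2)[OF a]])
  finally show ?thesis .
qed

lemma isometric_T_k: "isometric_linear_iso frakA (form_k \<alpha> \<beta> k) frakA l2_inner (T_k \<alpha> \<beta> k)"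
  unfolding isometric_linear_iso_def
proof (intro conjI ballI allI)
  let ?A = "(alpha_k \<alpha> \<beta> k, beta_k \<alpha> \<beta> k)"
  show "bij_betw (T_k \<alpha> \<beta> k) frakA frakA"
    unfolding T_k_eq
    by (rule bij_exp_shift) (simp only: inner_scaleR_left inner_scaleR_right inner_rot_self mult_zero_right)
  show "T_k \<alpha> \<beta> k (a + b) = T_k \<alpha> \<beta> k a + T_k \<alpha> \<beta> k b" if "a \<in> frakA" "b \<in> frakA" for a b
    using that by (simp add: T_k_eq exp_shift_def entire_ext_add fun_eq_iff distrib_left)
  show "T_k \<alpha> \<beta> k (fun_scale z a) = fun_scale z (T_k \<alpha> \<beta> k a)" if "a \<in> frakA" for z a
    unfolding T_k_eq exp_shift_def entire_ext_scale[OF that] by (simp add: fun_scale_def fun_eq_iff)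
  show "l2_inner (T_k \<alpha> \<beta> k a) (T_k \<alpha> \<beta> k b) = form_k \<alpha> \<beta> k a b" if a: "a \<in> frakA" and b: "b \<in> frakA" for a b
  proof -
    \<comment> \<open>One real exponential is taken by each argument. The extension of
      \<open>star b\<close> at the negative level is the conjugate of the extension of
      \<open>b\<close> at the positive one, so the integrand becomes that of
      \<open>l2_inner\<close>.\<close>
    have e: "complex_of_real (exp (2 * pi * (?A \<bullet> x))) = complex_of_real (exp ((pi *\<^sub>R ?A) \<bullet> x)) * complex_of_real (exp ((pi *\<^sub>R ?A) \<bullet> x))" for x
      unfolding of_real_mult[symmetric] exp_add[symmetric] inner_scaleR_left by simp
    show ?thesis
      unfolding form_k_eq[OF a b] l2_inner_def T_k_eq exp_shift_def e entire_ext_star_cplx2[OF b]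
      by (simp add: mult_ac)
  qed
qed

theorem proposition23:
  fixes q :: complex and \<alpha> \<beta> \<gamma> :: real and k :: "int \<times> int"
  assumes "cmod q = 1" and "q \<noteq> 1" and "q \<noteq> -1"
    and "q = exp (2 * complex_of_real pi * \<i> * complex_of_real \<gamma>)"
    and "\<alpha> * \<beta> = \<gamma>"
  shows "scalar_product_on frakA (form_k \<alpha> \<beta> k) \<and>
    unitary_space frakA (form_k \<alpha> \<beta> k) \<and>
    unitary_space frakA l2_inner \<and>
    isometric_linear_iso frakA (form_k \<alpha> \<beta> k) frakA l2_inner (T_k \<alpha> \<beta> k) \<and>
    (\<forall>a\<in>frakA. \<forall>b\<in>frakA. form_k \<alpha> \<beta> k a b =
       (LINT (x1, x2)|lborel.
          complex_of_real (exp (2 * pi * (alpha_k \<alpha> \<beta> k * x1 + beta_k \<alpha> \<beta> k * x2))) *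
          entire_ext a (complex_of_real x1 + \<i> * complex_of_real (beta_k \<alpha> \<beta> k) / 4,
                        complex_of_real x2 - \<i> * complex_of_real (alpha_k \<alpha> \<beta> k) / 4) *
          entire_ext (star b) (complex_of_real x1 - \<i> * complex_of_real (beta_k \<alpha> \<beta> k) / 4,
                               complex_of_real x2 + \<i> * complex_of_real (alpha_k \<alpha> \<beta> k) / 4)))"
proof (intro conjI ballI)
  show sp: "scalar_product_on frakA (form_k \<alpha> \<beta> k)"
    by (rule scalar_product_pullback[OF scalar_product_l2 subspace_frakA isometric_T_k])
  show "unitary_space frakA (form_k \<alpha> \<beta> k)" "unitary_space frakA l2_inner"
    using sp scalar_product_l2 subspace_frakA by (simp_all add: unitary_space_def)
  show "isometric_linear_iso frakA (form_k \<alpha> \<beta> k) frakA l2_inner (T_k \<alpha> \<beta> k)"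
    by (rule isometric_T_k)
  fix a b assume "a \<in> frakA" "b \<in> frakA"
  then show "form_k \<alpha> \<beta> k a b =
       (LINT (x1, x2)|lborel.
          complex_of_real (exp (2 * pi * (alpha_k \<alpha> \<beta> k * x1 + beta_k \<alpha> \<beta> k * x2))) *
          entire_ext a (complex_of_real x1 + \<i> * complex_of_real (beta_k \<alpha> \<beta> k) / 4,
                        complex_of_real x2 - \<i> * complex_of_real (alpha_k \<alpha> \<beta> k) / 4) *
          entire_ext (star b) (complex_of_real x1 - \<i> * complex_of_real (beta_k \<alpha> \<beta> k) / 4,
                               complex_of_real x2 + \<i> * complex_of_real (alpha_k \<alpha> \<beta> k) / 4))"
    by (simp add: form_k_eq case_prod_unfold rot_def cplx2_def Complex_eq inner_prod_def)
qed

end
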